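(* For each integer $n \geq 1$, there exists a $3$-dimensional polyhedral sphere with $5n+4$ vertices such that $n^2$ of its facets are combinatorially equivalent to a bipyramid.
   Context: A $3$-dimensional polyhedral sphere is a (finite, abstract) polyhedral complex homeomorphic to the $3$-sphere: its cells are combinatorially convex polytopes, glued along faces, every face of a cell is a cell of the complex, and any two cells intersect in a single (possibly empty) face of both. It is not required to be realized as the boundary complex of a convex $4$-polytope. Its facets are its cells of maximal dimension, i.e. its $3$-dimensional cells. A bipyramid is the unique (up to combinatorial equivalence) simplicial convex $3$-polytope with $5$ vertices. Two polytopes are combinatorially equivalent if their face lattices are isomorphic. *)

theory Defs
  imports "HOL-Analysis.Analysis"
begin

text \<open>
  A finite (abstract) polyhedral complex is given by its underlying space \<open>X\<close>, its finite set \<open>K\<close>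
  of cells, which are closed subsets of \<open>X\<close>, and for every cell \<open>C\<close> a convex polytope \<open>P C\<close> together
  with a homeomorphism \<open>h C\<close> from \<open>P C\<close> onto \<open>C\<close>. Nothing relates the polytopes of different
  cells metrically or affinely: only their faces and the topology of the gluing matter.

  The relation \<open>face_of\<close> includes the improper faces, so \<open>cell_faces P h C\<close> always contains
  \<open>{}\<close> and \<open>C\<close>, and every nonempty complex contains the empty cell (of dimension \<open>-1\<close>).
\<close>

definition cell_faces ::
    "('a set \<Rightarrow> 'b::euclidean_space set) \<Rightarrow> ('a set \<Rightarrow> 'b \<Rightarrow> 'a) \<Rightarrow> 'a set \<Rightarrow> 'a set set"
  where "cell_faces P h C = {h C ` F | F. F face_of P C}"

text \<open>
  As the cells are finitely many closed sets covering \<open>X\<close>, the topology of \<open>X\<close> is the one obtained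
  by gluing the polytopes. The last condition makes the gluing maps respect faces: a face of
  \<open>C\<close> contained in \<open>D\<close> is itself a cell, hence equals its intersection with \<open>D\<close>, hence is a
  face of \<open>D\<close>.
\<close>

definition polyhedral_complex ::
    "'a topology \<Rightarrow> 'a set set \<Rightarrow> ('a set \<Rightarrow> 'b::euclidean_space set) \<Rightarrow> ('a set \<Rightarrow> 'b \<Rightarrow> 'a) \<Rightarrow> bool"
  where "polyhedral_complex X K P h \<longleftrightarrow>
    finite K \<and> \<Union>K = topspace X \<and>
    (\<forall>C\<in>K. closedin X C \<and> polytope (P C) \<and>
       homeomorphic_map (top_of_set (P C)) (subtopology X C) (h C)) \<and>
    (\<forall>C\<in>K. cell_faces P h C \<subseteq> K) \<and>
    (\<forall>C\<in>K. \<forall>D\<in>K. C \<inter> D \<in> cell_faces P h C \<and> C \<inter> D \<in> cell_faces P h D)"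

definition cells_of_dim ::
    "'a set set \<Rightarrow> ('a set \<Rightarrow> 'b::euclidean_space set) \<Rightarrow> int \<Rightarrow> 'a set set"
  where "cells_of_dim K P d = {C \<in> K. aff_dim (P C) = d}"

text \<open>
  Polytopes of dimension at most 3 can be taken in \<open>real^3\<close>, and by invariance of domain a complex
  homeomorphic to the 3-sphere has no cells of larger dimension.
\<close>

definition polyhedral_3_sphere ::
    "'a topology \<Rightarrow> 'a set set \<Rightarrow> ('a set \<Rightarrow> (real^3) set) \<Rightarrow> ('a set \<Rightarrow> real^3 \<Rightarrow> 'a) \<Rightarrow> bool"
  where "polyhedral_3_sphere X K P h \<longleftrightarrow>
    polyhedral_complex X K P h \<and>
    X homeomorphic_space (top_of_set (sphere (0 :: real^4) 1))"

definition combinatorially_equivalent ::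
    "'a::euclidean_space set \<Rightarrow> 'b::euclidean_space set \<Rightarrow> bool"
  where "combinatorially_equivalent P Q \<longleftrightarrow>
    (\<exists>f. bij_betw f {F. F face_of P} {G. G face_of Q} \<and>
      (\<forall>F F'. F face_of P \<longrightarrow> F' face_of P \<longrightarrow> (F \<subseteq> F' \<longleftrightarrow> f F \<subseteq> f F')))"

definition bipyramid :: "(real^3) set \<Rightarrow> bool"
  where "bipyramid B \<longleftrightarrow>
    polytope B \<and> aff_dim B = 3 \<and> card {v. v extreme_point_of B} = 5 \<and>
    (\<forall>F. F facet_of B \<longrightarrow> 2 simplex F)"

end

theory Submission
  imports Defs
begin

text \<open>
  The join of two cycles of lengths \<open>n + 2\<close> and \<open>3 n + 2\<close> triangulates the 3-sphere, with one tetrahedron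
  for each square of a toroidal grid and one edge of degree four for each grid point. A monotone
  staircase of squares is a stacked ball; replace each of \<open>n\<close> disjoint diagonal staircases by the
  cone over its boundary from a new vertex. At an inner corner of a staircase the
  three tetrahedra of the staircase become two, while the fourth one survives, so the edge
  now has degree three. The \<open>n\<^sup>2\<close> edges obtained this way have disjoint open stars, and merging the
  three tetrahedra of each star yields a bipyramid. As coning off a staircase is a sequence of
  bistellar moves, which do not change the realization up to homeomorphism, the result is a sphere.
\<close>

section \<open>Realizations and bistellar moves\<close>

text \<open>The vertex count is (n + 2) + (3 n + 2) + n: the two cycles and one cone point per
  strip. Measured by column minus row, strip \<open>k\<close> uses the offsets 3 k and 3 k + 1, and
  the surviving squares at its inner corners have offset 3 k - 1 modulo 3 n + 2; this is why
  consecutive strips are three columns apart. Only the corners on one side of a strip are used, n of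
  them; those on the other side would mostly claim the same surviving squares.

  Triangulations are given by their facets alone, as vertex sets, and points are nonnegative weight
  functions, so that a simplex is a condition on supports. Merging tetrahedra then changes the list
  of cells but not the underlying space, and being a sphere needs no new argument. What merging does
  require is that cells still meet in common faces. This rests on two facts: the base triangle of a
  bipyramid, which is not a face of the bipyramid, is contained in no facet of the triangulation,
  and no facet contains two of the chosen edges.\<close>

definition geometric_simplex :: "'v set \<Rightarrow> ('v \<Rightarrow> real) set"
  where "geometric_simplex s = {f. (\<forall>v. 0 \<le> f v) \<and> (\<forall>v. v \<notin> s \<longrightarrow> f v = 0) \<and> sum f s = 1}"

definition realization :: "'v set set \<Rightarrow> ('v \<Rightarrow> real) set"
  where "realization T = (\<Union>t\<in>T. geometric_simplex t)"

text \<open>Normalizing the sum over a common finite set \<open>W\<close> leaves only the support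
  condition dependent on \<open>s\<close>, so simplices on different vertex sets can be compared
  coordinatewise.\<close>

lemma geometric_simplex_iff:
  assumes "finite W" "s \<subseteq> W"
  shows "f \<in> geometric_simplex s \<longleftrightarrow> (\<forall>v. 0 \<le> f v) \<and> (\<forall>v. v \<notin> s \<longrightarrow> f v = 0) \<and> sum f W = 1"
proof -
  have "sum f s = sum f W" if "\<forall>v. v \<notin> s \<longrightarrow> f v = 0"
    using that assms by (intro sum.mono_neutral_left) auto
  then show ?thesis unfolding geometric_simplex_def by auto
qed

lemma continuous_on_Min_coordinates:
  fixes \<sigma> :: "'v set"
  assumes "finite \<sigma>" "\<sigma> \<noteq> {}"
  shows "continuous_on S (\<lambda>f. Min (f ` \<sigma>) :: real)"
  using assms
proof (induction rule: finite_ne_induct)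
  case (singleton x)
  then show ?case by (simp add: continuous_on_product_then_coordinatewise[OF continuous_on_id])
next
  case (insert x F)
  have "continuous_on S (\<lambda>f. min (f x) (Min (f ` F)))"
    by (intro continuous_on_min insert continuous_on_product_then_coordinatewise[OF continuous_on_id])
  with insert show ?case by simp
qed

text \<open>The shift takes as much weight from \<sigma> as nonnegativity allows, until a smallest
  coordinate vanishes. The factor \<open>real (card \<sigma>) / real (card \<tau>)\<close> keeps the
  total weight unchanged.\<close>

definition shift :: "'v set \<Rightarrow> 'v set \<Rightarrow> ('v \<Rightarrow> real) \<Rightarrow> 'v \<Rightarrow> real"
  where "shift \<sigma> \<tau> f = (\<lambda>v. f v + Min (f ` \<sigma>) *
    (if v \<in> \<sigma> then -1 else if v \<in> \<tau> then real (card \<sigma>) / real (card \<tau>) else 0))"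

lemma continuous_on_shift:
  assumes "finite \<sigma>" "\<sigma> \<noteq> {}"
  shows "continuous_on S (shift \<sigma> \<tau>)"
  unfolding shift_def
  by (intro continuous_on_coordinatewise_then_product continuous_intros
      continuous_on_Min_coordinates[OF assms] continuous_on_product_then_coordinatewise[OF continuous_on_id])

text \<open>One half of the homeomorphism belonging to a bistellar move. The other half arises by
  exchanging \<sigma> and \<tau>, so the hypotheses lead only from \<open>T\<close> to
  \<open>T'\<close>.\<close>

lemma shift_realization:
  assumes fin: "finite \<sigma>" "\<sigma> \<noteq> {}" "finite \<tau>" "\<tau> \<noteq> {}" "\<sigma> \<inter> \<tau> = {}"
    and finT: "\<And>t. t \<in> T \<Longrightarrow> finite t"
    and finT': "\<And>t. t \<in> T' \<Longrightarrow> finite t"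
    and T: "\<And>t. t \<in> T \<Longrightarrow> \<not> \<tau> \<subseteq> t"
    and T_in: "\<And>t s. t \<in> T \<Longrightarrow> \<sigma> \<subseteq> t \<Longrightarrow> s \<in> \<sigma> \<Longrightarrow> \<exists>t'\<in>T'. t - {s} \<union> \<tau> \<subseteq> t'"
    and T_out: "\<And>t. t \<in> T \<Longrightarrow> \<not> \<sigma> \<subseteq> t \<Longrightarrow> \<exists>t'\<in>T'. t \<subseteq> t'"
    and f: "f \<in> realization T"
  shows "shift \<sigma> \<tau> f \<in> realization T'" and "shift \<tau> \<sigma> (shift \<sigma> \<tau> f) = f"
proof -
  obtain t where t: "t \<in> T" "f \<in> geometric_simplex t"
    using f by (auto simp: realization_def)
  have f0: "0 \<le> f v" and supp: "v \<notin> t \<Longrightarrow> f v = 0" for v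
    using t by (auto simp: geometric_simplex_def)
  define m where "m = Min (f ` \<sigma>)"
  have m_le: "m \<le> f v" if "v \<in> \<sigma>" for v
    using that fin by (auto simp: m_def)
  \<comment> \<open>The minimum is attained at \<open>s\<close>, which therefore drops out of the
    support of the shifted point; this makes the point fit into
    \<open>t - {s} \<union> \<tau>\<close>.\<close>
  obtain s where s: "s \<in> \<sigma>" "f s = m"
    using Min_in[of "f ` \<sigma>"] fin unfolding m_def by (metis (no_types) finite_imageI image_iff image_is_empty)
  have m0: "0 \<le> m" using s f0 by metis
  \<comment> \<open>No facet in \<open>T\<close> contains \<tau>, so some coordinate on \<tau> is
    zero. After the shift it is the smallest one on \<tau>, hence the reverse shift moves back
    exactly the same amount.\<close>
  obtain u where u: "u \<in> \<tau>" "f u = 0"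
    using T[OF t(1)] supp by blast
  have c: "real (card \<sigma>) > 0" "real (card \<tau>) > 0"
    using fin by (auto simp: card_gt_0_iff)
  define g where "g = shift \<sigma> \<tau> f"
  have g: "g v = f v + m * (if v \<in> \<sigma> then -1 else if v \<in> \<tau> then real (card \<sigma>) / real (card \<tau>) else 0)" for v
    by (simp add: g_def shift_def m_def)
  have g0: "0 \<le> g v" for v
    using m_le[of v] f0[of v] m0 c by (auto simp: g)
  have sum_g: "sum g W = sum f W" if W: "finite W" "\<sigma> \<subseteq> W" "\<tau> \<subseteq> W" for W
  proof -
    define d where "d v = (if v \<in> \<sigma> then -1 else if v \<in> \<tau> then real (card \<sigma>) / real (card \<tau>) else 0)" for v
    have "sum d W = sum d (\<sigma> \<union> \<tau>)"
      using W by (intro sum.mono_neutral_right) (auto simp: d_def)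
    also have "\<dots> = sum d \<sigma> + sum d \<tau>"
      using fin by (intro sum.union_disjoint) auto
    also have "sum d \<sigma> = - real (card \<sigma>)"
      by (simp add: d_def)
    also have "sum d \<tau> = (\<Sum>v\<in>\<tau>. real (card \<sigma>) / real (card \<tau>))"
      using fin by (intro sum.cong) (auto simp: d_def)
    also have "\<dots> = real (card \<sigma>)"
      using c by simp
    finally have "sum d W = 0" by simp
    moreover have "sum g W = sum f W + m * sum d W"
      by (simp add: g d_def sum.distrib sum_distrib_left)
    ultimately show ?thesis by simp
  qed
  have mem: "g \<in> geometric_simplex t'" if t': "t' \<in> T'" "\<And>v. v \<notin> t' \<Longrightarrow> g v = 0" for t'
  proof -
    define W where "W = t \<union> t' \<union> \<sigma> \<union> \<tau>"
    have W: "finite W" "t \<subseteq> W" "t' \<subseteq> W" "\<sigma> \<subseteq> W" "\<tau> \<subseteq> W"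
      using fin finT[OF t(1)] finT'[OF t'(1)] by (auto simp: W_def)
    have "sum f W = 1"
      using t(2) geometric_simplex_iff[OF W(1,2)] by blast
    then show ?thesis
      using g0 t'(2) sum_g[OF W(1,4,5)] geometric_simplex_iff[OF W(1,3)] by auto
  qed
  show "shift \<sigma> \<tau> f \<in> realization T'"
  proof (cases "\<sigma> \<subseteq> t")
    case True
    obtain t' where t': "t' \<in> T'" "t - {s} \<union> \<tau> \<subseteq> t'"
      using T_in[OF t(1) True s(1)] by blast
    have "g v = 0" if "v \<notin> t'" for v
      using that t'(2) supp[of v] s True by (cases "v = s") (auto simp: g)
    then show ?thesis using mem[OF t'(1)] t'(1) unfolding g_def realization_def by blast
  next
    case False
    then obtain v where "v \<in> \<sigma>" "f v = 0" using supp by blast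
    \<comment> \<open>Away from the simplices containing \<sigma> the map is the identity.\<close>
    then have "m = 0" using m_le m0 by fastforce
    then have "g = f" by (auto simp: g)
    obtain t' where t': "t' \<in> T'" "t \<subseteq> t'"
      using T_out[OF t(1) False] by blast
    have "g v = 0" if "v \<notin> t'" for v
      using that t'(2) supp[of v] \<open>g = f\<close> by auto
    then show ?thesis using mem[OF t'(1)] t'(1) unfolding g_def realization_def by blast
  qed
  have "Min (g ` \<tau>) = m * real (card \<sigma>) / real (card \<tau>)"
  proof (rule Min_eqI)
    show "m * real (card \<sigma>) / real (card \<tau>) \<in> g ` \<tau>"
      using u fin by (intro image_eqI[of _ _ u]) (auto simp: g)
    show "m * real (card \<sigma>) / real (card \<tau>) \<le> y" if "y \<in> g ` \<tau>" for y
    proof -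
      obtain v where v: "v \<in> \<tau>" "y = g v" using \<open>y \<in> g ` \<tau>\<close> by blast
      moreover from v(1) fin(5) have "v \<notin> \<sigma>" by blast
      ultimately show ?thesis using f0[of v] by (simp add: g)
    qed
  qed (use fin in auto)
  then have "shift \<tau> \<sigma> g v = f v" for v
    unfolding shift_def[of \<tau> \<sigma>] using fin c by (auto simp: g)
  then show "shift \<tau> \<sigma> (shift \<sigma> \<tau> f) = f" by (auto simp: g_def)
qed

text \<open>
  A bistellar move, or a stellar subdivision when \<open>\<tau>\<close> is a single new vertex. With
  \<open>L\<close> the link of \<open>\<sigma>\<close> modulo \<open>\<tau>\<close>, it replaces \<open>\<sigma> * \<partial>\<tau> * L\<close> by \<open>\<partial>\<sigma> * \<tau> * L\<close>. The map shifts
  barycentric coordinates along the affine relation that puts the barycentres of \<open>\<sigma>\<close> and \<open>\<tau>\<close>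
  at the same point.
\<close>

lemma bistellar_homeomorphic:
  assumes fin: "finite \<sigma>" "\<sigma> \<noteq> {}" "finite \<tau>" "\<tau> \<noteq> {}" "\<sigma> \<inter> \<tau> = {}"
    and finT: "\<And>t. t \<in> T \<Longrightarrow> finite t"
    and finT': "\<And>t. t \<in> T' \<Longrightarrow> finite t"
    and T: "\<And>t. t \<in> T \<Longrightarrow> \<not> \<tau> \<subseteq> t"
    and T_in: "\<And>t s. t \<in> T \<Longrightarrow> \<sigma> \<subseteq> t \<Longrightarrow> s \<in> \<sigma> \<Longrightarrow> \<exists>t'\<in>T'. t - {s} \<union> \<tau> \<subseteq> t'"
    and T_out: "\<And>t. t \<in> T \<Longrightarrow> \<not> \<sigma> \<subseteq> t \<Longrightarrow> \<exists>t'\<in>T'. t \<subseteq> t'"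
    and T': "\<And>t. t \<in> T' \<Longrightarrow> \<not> \<sigma> \<subseteq> t"
    and T'_in: "\<And>t s. t \<in> T' \<Longrightarrow> \<tau> \<subseteq> t \<Longrightarrow> s \<in> \<tau> \<Longrightarrow> \<exists>t'\<in>T. t - {s} \<union> \<sigma> \<subseteq> t'"
    and T'_out: "\<And>t. t \<in> T' \<Longrightarrow> \<not> \<tau> \<subseteq> t \<Longrightarrow> \<exists>t'\<in>T. t \<subseteq> t'"
  shows "realization T homeomorphic realization T'"
proof -
  have fin': "\<tau> \<inter> \<sigma> = {}" using fin by blast
  note A = shift_realization[OF fin finT finT' T T_in T_out]
  note B = shift_realization[OF fin(3,4,1,2) fin' finT' finT T' T'_in T'_out]
  have "homeomorphism (realization T) (realization T') (shift \<sigma> \<tau>) (shift \<tau> \<sigma>)"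
  proof (rule homeomorphismI)
    show "shift \<sigma> \<tau> ` realization T \<subseteq> realization T'" using A(1) by blast
    show "shift \<tau> \<sigma> ` realization T' \<subseteq> realization T" using B(1) by blast
  qed (use A B fin in \<open>simp_all add: continuous_on_shift\<close>)
  then show ?thesis by (auto simp: homeomorphic_def)
qed

text \<open>The vertex type may be infinite, so compactness comes from Tychonoff: the coordinates
  range over \<open>{0..1}\<close> on \<open>s\<close> and over \<open>{0}\<close> elsewhere, and
  the sum condition is closed.\<close>

lemma compact_geometric_simplex:
  assumes "finite s"
  shows "compact (geometric_simplex s)"
proof -
  have "compact_space (product_topology (\<lambda>v. top_of_set (if v \<in> s then {0..1::real} else {0})) UNIV)"
    by (rule compact_space_product_topology[THEN iffD2]) (auto simp: compact_space_subtopology)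
  then have "compactin (product_topology (\<lambda>_. euclidean) UNIV) (PiE UNIV (\<lambda>v. if v \<in> s then {0..1::real} else {0}))"
    by (subst compactin_PiE) auto
  then have "compact (PiE UNIV (\<lambda>v. if v \<in> s then {0..1::real} else {0}))"
    by (simp add: euclidean_product_topology)
  moreover have "closed {f :: 'a \<Rightarrow> real. sum f s = 1}"
    by (intro closed_Collect_eq continuous_intros continuous_on_product_then_coordinatewise[OF continuous_on_id])
  moreover have "geometric_simplex s = (PiE UNIV (\<lambda>v. if v \<in> s then {0..1::real} else {0})) \<inter> {f. sum f s = 1}"
  proof -
    have "f v \<le> 1" if "\<forall>v. 0 \<le> f v" "sum f s = 1" "v \<in> s" for f :: "'a \<Rightarrow> real" and v
      using member_le_sum[of v s f] that assms by simp
    then show ?thesis by (auto simp: geometric_simplex_def PiE_def Pi_def) (metis less_eq_real_def)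
  qed
  ultimately show ?thesis by (simp add: compact_Int_closed)
qed

section \<open>Joins of cycles\<close>

definition join :: "'v set set \<Rightarrow> 'v set set \<Rightarrow> 'v set set"
  where "join A B = {e \<union> e' | e e'. e \<in> A \<and> e' \<in> B}"

lemma joinI: "e \<in> A \<Longrightarrow> e' \<in> B \<Longrightarrow> e \<union> e' \<in> join A B"
  unfolding join_def by blast

lemma joinE:
  assumes "t \<in> join A B"
  obtains e e' where "e \<in> A" "e' \<in> B" "t = e \<union> e'"
  using assms unfolding join_def by blast

lemma join_commute: "join A B = join B A"
  unfolding join_def by blast

definition cycle_edges :: "(nat \<Rightarrow> 'v) \<Rightarrow> nat \<Rightarrow> 'v set set"
  where "cycle_edges f p = insert {f (p - 1), f 0} {{f i, f (Suc i)} | i. Suc i < p}"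

text \<open>Nonnegative numbers, one of which is zero, are determined by their differences. Below,
  this recovers barycentric coordinates on the boundary of a triangle.\<close>

lemma max_shift_eq:
  fixes x y z :: real
  assumes "0 \<le> x" "0 \<le> y" "0 \<le> z" "x = 0 \<or> y = 0 \<or> z = 0"
  shows "max 0 (max (x - y) (x - z)) = x"
  using assms by auto

text \<open>The cone over the boundary of a triangle consists of the nonnegative triples with a zero
  entry, and taking differences identifies it with the plane. Hence the cone over the join is a
  product of two planes, by a positively homogeneous bijection, and the join itself becomes the unit
  sphere by rescaling.\<close>

lemma join_triangles_homeomorphic_sphere:
  fixes a0 a1 a2 b0 b1 b2 :: 'v
  assumes dist: "distinct [a0, a1, a2, b0, b1, b2]"
  defines "T \<equiv> join {{a0, a1}, {a1, a2}, {a2, a0}} {{b0, b1}, {b1, b2}, {b2, b0}}"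
  shows "realization T homeomorphic sphere (0 :: real^4) 1"
proof -
  have ne: "a0 \<noteq> a1" "a0 \<noteq> a2" "a1 \<noteq> a2" "b0 \<noteq> b1" "b0 \<noteq> b2" "b1 \<noteq> b2"
    "a0 \<noteq> b0" "a0 \<noteq> b1" "a0 \<noteq> b2" "a1 \<noteq> b0" "a1 \<noteq> b1" "a1 \<noteq> b2" "a2 \<noteq> b0" "a2 \<noteq> b1" "a2 \<noteq> b2"
    using dist by auto
  define W where "W = {a0, a1, a2, b0, b1, b2}"
  have "finite W" by (simp add: W_def)
  have sum_W: "sum F W = F a0 + F a1 + F a2 + F b0 + F b1 + F b2" for F :: "'v \<Rightarrow> real"
    using ne by (simp add: W_def)
  define cone where "cone = {F :: 'v \<Rightarrow> real. (\<forall>v. 0 \<le> F v) \<and> (\<forall>v. v \<notin> W \<longrightarrow> F v = 0) \<and>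
    (F a0 = 0 \<or> F a1 = 0 \<or> F a2 = 0) \<and> (F b0 = 0 \<or> F b1 = 0 \<or> F b2 = 0)}"
  have real_iff: "F \<in> realization T \<longleftrightarrow> F \<in> cone \<and> sum F W = 1" for F
  proof -
    have "F \<in> geometric_simplex t \<longleftrightarrow> (\<forall>v. 0 \<le> F v) \<and> (\<forall>v. v \<notin> t \<longrightarrow> F v = 0) \<and> sum F W = 1"
      if "t \<in> T" for t
      using that by (intro geometric_simplex_iff \<open>finite W\<close>) (auto simp: T_def join_def W_def)
    then have "F \<in> realization T \<longleftrightarrow> (\<exists>t\<in>T. (\<forall>v. 0 \<le> F v) \<and> (\<forall>v. v \<notin> t \<longrightarrow> F v = 0) \<and> sum F W = 1)"
      by (auto simp: realization_def)
    also have "\<dots> \<longleftrightarrow> (\<forall>v. 0 \<le> F v) \<and> sum F W = 1 \<and> (\<exists>t\<in>T. \<forall>v. v \<notin> t \<longrightarrow> F v = 0)"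
      by blast
    also have "(\<exists>t\<in>T. \<forall>v. v \<notin> t \<longrightarrow> F v = 0) \<longleftrightarrow> (\<forall>v. v \<notin> W \<longrightarrow> F v = 0) \<and>
        (F a0 = 0 \<or> F a1 = 0 \<or> F a2 = 0) \<and> (F b0 = 0 \<or> F b1 = 0 \<or> F b2 = 0)"
      (is "?L \<longleftrightarrow> ?R")
    proof
      assume ?L
      then obtain e e' where e: "e \<in> {{a0, a1}, {a1, a2}, {a2, a0}}" "e' \<in> {{b0, b1}, {b1, b2}, {b2, b0}}"
        "\<forall>v. v \<notin> e \<union> e' \<longrightarrow> F v = 0"
        by (auto simp: T_def join_def)
      have "a2 \<notin> e \<union> e' \<or> a0 \<notin> e \<union> e' \<or> a1 \<notin> e \<union> e'" "b2 \<notin> e \<union> e' \<or> b0 \<notin> e \<union> e' \<or> b1 \<notin> e \<union> e'"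
        using e(1,2) ne by auto
      moreover have "e \<union> e' \<subseteq> W" using e(1,2) by (auto simp: W_def)
      ultimately show ?R using e(3) by blast
    next
      assume R: ?R
      obtain e where e: "e \<in> {{a0, a1}, {a1, a2}, {a2, a0}}" "\<forall>v. v \<in> {a0, a1, a2} - e \<longrightarrow> F v = 0"
      proof -
        consider "F a0 = 0" | "F a1 = 0" | "F a2 = 0" using R by blast
        then show ?thesis
        proof cases
          case 1 then show ?thesis using that[of "{a1, a2}"] by auto
        next
          case 2 then show ?thesis using that[of "{a2, a0}"] by auto
        next
          case 3 then show ?thesis using that[of "{a0, a1}"] by auto
        qed
      qed
      obtain e' where e': "e' \<in> {{b0, b1}, {b1, b2}, {b2, b0}}" "\<forall>v. v \<in> {b0, b1, b2} - e' \<longrightarrow> F v = 0"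
      proof -
        consider "F b0 = 0" | "F b1 = 0" | "F b2 = 0" using R by blast
        then show ?thesis
        proof cases
          case 1 then show ?thesis using that[of "{b1, b2}"] by auto
        next
          case 2 then show ?thesis using that[of "{b2, b0}"] by auto
        next
          case 3 then show ?thesis using that[of "{b0, b1}"] by auto
        qed
      qed
      have "e \<union> e' \<in> T" using e e' by (auto simp: T_def join_def)
      moreover have "F v = 0" if "v \<notin> e \<union> e'" for v
        using that e(2) e'(2) R by (auto simp: W_def)
      ultimately show ?L by blast
    qed
    finally show ?thesis by (auto simp: cone_def)
  qed
  define G :: "('v \<Rightarrow> real) \<Rightarrow> (real \<times> real) \<times> (real \<times> real)" where
    "G F = ((F a1 - F a0, F a2 - F a0), (F b1 - F b0, F b2 - F b0))" for F
  \<comment> \<open>\<open>A\<close> and \<open>B\<close> recover \<open>F a0\<close> and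
    \<open>F b0\<close> from the differences recorded by \<open>G\<close>.\<close>
  define A :: "(real \<times> real) \<times> (real \<times> real) \<Rightarrow> real" where
    "A u = max 0 (max (- fst (fst u)) (- snd (fst u)))" for u
  define B :: "(real \<times> real) \<times> (real \<times> real) \<Rightarrow> real" where
    "B u = max 0 (max (- fst (snd u)) (- snd (snd u)))" for u
  define H :: "(real \<times> real) \<times> (real \<times> real) \<Rightarrow> 'v \<Rightarrow> real" where
    "H u v = (if v = a0 then A u else if v = a1 then A u + fst (fst u) else if v = a2 then A u + snd (fst u)
      else if v = b0 then B u else if v = b1 then B u + fst (snd u) else if v = b2 then B u + snd (snd u)
      else 0)" for u v
  have H_vals: "H u a0 = A u" "H u a1 = A u + fst (fst u)" "H u a2 = A u + snd (fst u)"
    "H u b0 = B u" "H u b1 = B u + fst (snd u)" "H u b2 = B u + snd (snd u)" for u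
    using ne by (simp_all add: H_def)
  have GH: "G (H u) = u" for u
    by (simp add: G_def H_vals)
  have H_cone: "H u \<in> cone" for u
  proof -
    have "0 \<le> H u v" for v
      by (auto simp: H_def A_def B_def max_def)
    moreover have "H u v = 0" if "v \<notin> W" for v
      using that by (auto simp: H_def W_def)
    moreover have "H u a0 = 0 \<or> H u a1 = 0 \<or> H u a2 = 0" "H u b0 = 0 \<or> H u b1 = 0 \<or> H u b2 = 0"
      unfolding H_vals by (auto simp: A_def B_def max_def)
    ultimately show ?thesis by (simp add: cone_def)
  qed
  have HG: "H (G F) = F" if F: "F \<in> cone" for F
  proof -
    have "A (G F) = F a0" "B (G F) = F b0"
      using F max_shift_eq[of "F a0" "F a1" "F a2"] max_shift_eq[of "F b0" "F b1" "F b2"]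
      by (simp_all add: A_def B_def G_def cone_def)
    then show ?thesis
      using F by (auto simp: H_def G_def cone_def W_def)
  qed
  \<comment> \<open>Positive homogeneity makes the two normalizations, by the norm and by the total
    weight, inverse to each other.\<close>
  have A_scale: "A (c *\<^sub>R u) = c * A u" "B (c *\<^sub>R u) = c * B u" if "0 \<le> c" for c u
    using that by (simp_all add: A_def B_def max_mult_distrib_left)
  have H_scale: "H (c *\<^sub>R u) = (\<lambda>v. c * H u v)" if "0 \<le> c" for c u
    using that by (auto simp: H_def A_scale algebra_simps)
  have G_scale: "G (\<lambda>v. c * F v) = c *\<^sub>R G F" for c F
    by (simp add: G_def algebra_simps)
  have cont_A: "continuous_on UNIV A" "continuous_on UNIV B"
    unfolding A_def B_def by (intro continuous_intros)+
  have cont_H: "continuous_on UNIV (\<lambda>u. H u v)" for v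
  proof -
    have "continuous_on UNIV (\<lambda>u. A u + fst (fst u))" "continuous_on UNIV (\<lambda>u. A u + snd (fst u))"
      "continuous_on UNIV (\<lambda>u. B u + fst (snd u))" "continuous_on UNIV (\<lambda>u. B u + snd (snd u))"
      by (intro continuous_intros cont_A)+
    with cont_A show ?thesis unfolding H_def
      by (cases "v = a0"; cases "v = a1"; cases "v = a2"; cases "v = b0"; cases "v = b1"; cases "v = b2"; simp)
  qed
  have cont_G: "continuous_on UNIV G"
    unfolding G_def by (intro continuous_intros continuous_on_product_then_coordinatewise[OF continuous_on_id])
  have "realization T homeomorphic sphere (0 :: (real \<times> real) \<times> (real \<times> real)) 1"
    unfolding homeomorphic_def
  proof (intro exI homeomorphismI)
    let ?g = "\<lambda>F. G F /\<^sub>R norm (G F)"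
    let ?h = "\<lambda>u v. H u v / sum (H u) W"
    have G0: "G F \<noteq> 0" if "F \<in> realization T" for F
    proof
      assume "G F = 0"
      then have "H 0 = F" using that HG[of F] real_iff[of F] by simp
      then have "F = (\<lambda>_. 0)" using H_scale[of 0 0] by auto
      then show False using that real_iff[of F] by simp
    qed
    have Hpos: "sum (H u) W > 0" if "u \<noteq> 0" for u
    proof -
      have "sum (H u) W \<noteq> 0"
      proof
        assume "sum (H u) W = 0"
        then have "\<forall>v\<in>W. H u v = 0"
          using H_cone[of u] by (subst (asm) sum_nonneg_eq_0_iff) (auto simp: cone_def \<open>finite W\<close>)
        then have "G (H u) = 0" by (simp add: G_def W_def zero_prod_def)
        then show False using GH[of u] that by simp
      qed
      moreover have "sum (H u) W \<ge> 0" using H_cone[of u] by (intro sum_nonneg) (auto simp: cone_def)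
      ultimately show ?thesis by linarith
    qed
    show "continuous_on (realization T) ?g"
      using G0 by (intro continuous_intros continuous_on_subset[OF cont_G]) auto
    show "continuous_on (sphere 0 1) ?h"
    proof (intro continuous_on_coordinatewise_then_product continuous_on_divide continuous_on_sum)
      show "\<forall>u\<in>sphere 0 1. sum (H u) W \<noteq> 0"
      proof
        fix u :: "(real \<times> real) \<times> (real \<times> real)" assume "u \<in> sphere 0 1"
        then have "u \<noteq> 0" by auto
        then show "sum (H u) W \<noteq> 0" using Hpos[of u] by linarith
      qed
    qed (rule continuous_on_subset[OF cont_H], simp)+
    show "?g ` realization T \<subseteq> sphere 0 1"
      using G0 by auto
    show "?h ` sphere 0 1 \<subseteq> realization T"
    proof clarify
      fix u :: "(real \<times> real) \<times> (real \<times> real)" assume "u \<in> sphere 0 1"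
      then have "u \<noteq> 0" by auto
      with Hpos have p: "sum (H u) W > 0" by blast
      have "?h u \<in> cone" using H_cone[of u] p by (auto simp: cone_def)
      moreover have "sum (?h u) W = 1" using p by (simp flip: sum_divide_distrib)
      ultimately show "?h u \<in> realization T" by (simp add: real_iff)
    qed
    show "?h (?g F) = F" if "F \<in> realization T" for F
    proof -
      have "H (?g F) = (\<lambda>v. inverse (norm (G F)) * F v)"
        using that real_iff[of F] HG[of F] H_scale[of "inverse (norm (G F))" "G F"] by simp
      moreover have "sum F W = 1" using that real_iff by blast
      ultimately show ?thesis using G0[OF that]
        by (simp flip: sum_distrib_left)
    qed
    show "?g (?h u) = u" if "u \<in> sphere 0 1" for u
    proof -
      have "u \<noteq> 0" using that by auto
      with Hpos have p: "sum (H u) W > 0" by blast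
      have "G (?h u) = (1 / sum (H u) W) *\<^sub>R u"
        using G_scale[of "1 / sum (H u) W" "H u"] GH[of u] by simp
      with p that show ?thesis by simp
    qed
  qed
  also have "sphere (0 :: (real \<times> real) \<times> (real \<times> real)) 1 homeomorphic sphere (0 :: real^4) 1"
    by (rule homeomorphic_spheres') auto
  finally show ?thesis .
qed

text \<open>Subdividing an edge of one factor is a stellar subdivision of the join: in each facet
  containing the edge, the edge is replaced by either half, whatever the part from \<open>D\<close>
  is.\<close>

lemma join_subdivide_edge:
  assumes e: "{a, b} \<in> C" and "a \<noteq> b"
    and card: "\<And>e. e \<in> C \<Longrightarrow> card e = 2" "\<And>e. e \<in> D \<Longrightarrow> card e = 2"
    and disj: "\<Union>C \<inter> \<Union>D = {}" and r: "r \<notin> \<Union>C" "r \<notin> \<Union>D"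
  shows "realization (join C D) homeomorphic realization (join (C - {{a, b}} \<union> {{a, r}, {r, b}}) D)"
proof (rule bistellar_homeomorphic[where \<sigma> = "{a, b}" and \<tau> = "{r}"])
  have card_fin: "finite e" if "card e = 2" for e :: "'a set"
    using that by (metis card.infinite zero_neq_numeral)
  have ab: "e = {a, b}" if "e \<in> C" "a \<in> e" "b \<in> e" for e
    using card_subset_eq[of e "{a, b}"] card(1)[OF that(1)] card_fin that \<open>a \<noteq> b\<close> by simp
  have ab_D: "a \<notin> \<Union>D" "b \<notin> \<Union>D" "a \<noteq> r" "b \<noteq> r" using e disj r by blast+
  show "finite t" if "t \<in> join C D" for t
    using that card_fin card by (auto simp: join_def)
  show "finite t" if "t \<in> join (C - {{a, b}} \<union> {{a, r}, {r, b}}) D" for t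
    using that card_fin card by (auto simp: join_def)
  show "{a, b} \<inter> {r} = {}" using e r by auto
  show "\<not> {r} \<subseteq> t" if "t \<in> join C D" for t
    using that r by (auto simp: join_def)
  show "\<exists>t'\<in>join (C - {{a, b}} \<union> {{a, r}, {r, b}}) D. t - {s} \<union> {r} \<subseteq> t'"
    if t: "t \<in> join C D" "{a, b} \<subseteq> t" and s: "s \<in> {a, b}" for t s
  proof -
    obtain e' where e': "e' \<in> D" "t = {a, b} \<union> e'"
      using t ab ab_D unfolding join_def by blast
    have "{a, r} \<union> e' \<in> join (C - {{a, b}} \<union> {{a, r}, {r, b}}) D"
      "{r, b} \<union> e' \<in> join (C - {{a, b}} \<union> {{a, r}, {r, b}}) D"
      using e' unfolding join_def by blast+
    moreover have "t - {s} \<union> {r} \<subseteq> {a, r} \<union> e' \<or> t - {s} \<union> {r} \<subseteq> {r, b} \<union> e'"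
      using s e' by auto
    ultimately show ?thesis by blast
  qed
  show "\<exists>t'\<in>join (C - {{a, b}} \<union> {{a, r}, {r, b}}) D. t \<subseteq> t'" if "t \<in> join C D" "\<not> {a, b} \<subseteq> t" for t
    using that unfolding join_def by blast
  show "\<not> {a, b} \<subseteq> t" if t: "t \<in> join (C - {{a, b}} \<union> {{a, r}, {r, b}}) D" for t
  proof
    assume "{a, b} \<subseteq> t"
    obtain e e' where e': "e \<in> C - {{a, b}} \<union> {{a, r}, {r, b}}" "e' \<in> D" "t = e \<union> e'"
      using t by (rule joinE)
    have "a \<notin> e'" "b \<notin> e'" using e'(2) ab_D by blast+
    then have "a \<in> e" "b \<in> e" using \<open>{a, b} \<subseteq> t\<close> e'(3) by blast+
    then show False using e'(1) ab[of e] ab_D \<open>a \<noteq> b\<close> by blast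
  qed
  show "\<exists>t'\<in>join C D. t - {s} \<union> {a, b} \<subseteq> t'"
    if t: "t \<in> join (C - {{a, b}} \<union> {{a, r}, {r, b}}) D" "{r} \<subseteq> t" and s: "s \<in> {r}" for t s
  proof -
    obtain e e' where e': "e \<in> C - {{a, b}} \<union> {{a, r}, {r, b}}" "e' \<in> D" "t = e \<union> e'"
      using t(1) by (rule joinE)
    have "r \<notin> e'" using e'(2) r(2) by blast
    then have "r \<in> e" using t(2) e'(3) by blast
    then have e_r: "e = {a, r} \<or> e = {r, b}" using e'(1) r(1) by blast
    have "{a, b} \<union> e' \<in> join C D" using e e'(2) by (rule joinI)
    moreover have "t - {s} \<union> {a, b} \<subseteq> {a, b} \<union> e'" using e'(3) e_r s by blast
    ultimately show ?thesis by blast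
  qed
  show "\<exists>t'\<in>join C D. t \<subseteq> t'" if "t \<in> join (C - {{a, b}} \<union> {{a, r}, {r, b}}) D" "\<not> {r} \<subseteq> t" for t
    using that unfolding join_def by blast
qed auto

text \<open>Lengthening the cycle subdivides its closing edge. In a cycle of length 2 that edge
  would coincide with the other one, which the bound on \<open>p\<close> excludes.\<close>

lemma cycle_edges_Suc:
  assumes "inj f" "3 \<le> p"
  shows "cycle_edges f (Suc p) = cycle_edges f p - {{f (p - 1), f 0}} \<union> {{f (p - 1), f p}, {f p, f 0}}"
proof -
  have "{f i, f (Suc i)} \<noteq> {f (p - 1), f 0}" if "Suc i < p" for i
    using that assms by (auto simp: doubleton_eq_iff inj_eq)
  moreover have "{{f i, f (Suc i)} | i. Suc i < Suc p} = insert {f (p - 1), f p} {{f i, f (Suc i)} | i. Suc i < p}"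
  proof -
    have "Suc i < Suc p \<longleftrightarrow> Suc i < p \<or> i = p - 1" for i
      using assms(2) by auto
    then have "{{f i, f (Suc i)} | i. Suc i < Suc p} =
        insert {f (p - 1), f (Suc (p - 1))} {{f i, f (Suc i)} | i. Suc i < p}"
      by (simp only:) blast
    moreover have "Suc (p - 1) = p" using assms(2) by simp
    ultimately show ?thesis by simp
  qed
  ultimately show ?thesis unfolding cycle_edges_def by auto
qed

lemma cycle_edges_card:
  assumes "inj f" "3 \<le> p" "e \<in> cycle_edges f p"
  shows "card e = 2"
proof -
  have "f (p - 1) \<noteq> f 0" "f i \<noteq> f (Suc i)" for i
    using assms(1,2) by (auto simp: inj_eq)
  then show ?thesis using assms(3) by (auto simp: cycle_edges_def)
qed

lemma Union_cycle_edges: "3 \<le> p \<Longrightarrow> \<Union>(cycle_edges f p) \<subseteq> f ` {..<p}"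
  by (auto simp: cycle_edges_def)

lemma join_cycles_Suc:
  assumes f: "inj f" "3 \<le> p" and g: "inj g" "3 \<le> q" and fg: "range f \<inter> range g = {}"
  shows "realization (join (cycle_edges f p) (cycle_edges g q)) homeomorphic
    realization (join (cycle_edges f (Suc p)) (cycle_edges g q))"
  unfolding cycle_edges_Suc[OF f]
proof (rule join_subdivide_edge)
  show "{f (p - 1), f 0} \<in> cycle_edges f p" by (simp add: cycle_edges_def)
  show "f (p - 1) \<noteq> f 0" using f by (simp add: inj_eq)
  show "\<Union>(cycle_edges f p) \<inter> \<Union>(cycle_edges g q) = {}"
    using Union_cycle_edges[OF f(2), of f] Union_cycle_edges[OF g(2), of g] fg by blast
  show "f p \<notin> \<Union>(cycle_edges f p)"
    using Union_cycle_edges[OF f(2), of f] f(1) by (meson inj_image_mem_iff lessThan_iff less_irrefl subsetD)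
  show "f p \<notin> \<Union>(cycle_edges g q)"
  proof -
    have "\<Union>(cycle_edges g q) \<subseteq> range g"
      using Union_cycle_edges[OF g(2), of g] by (rule order_trans) auto
    then show ?thesis using fg by (meson disjoint_iff rangeI subsetD)
  qed
  show "\<And>e. e \<in> cycle_edges f p \<Longrightarrow> card e = 2" "\<And>e. e \<in> cycle_edges g q \<Longrightarrow> card e = 2"
    using cycle_edges_card[OF f] cycle_edges_card[OF g] by simp_all
qed

lemma join_cycles_homeomorphic_sphere:
  fixes f g :: "nat \<Rightarrow> 'v"
  assumes f: "inj f" "3 \<le> p" and g: "inj g" "3 \<le> q" and fg: "range f \<inter> range g = {}"
  shows "realization (join (cycle_edges f p) (cycle_edges g q)) homeomorphic sphere (0 :: real^4) 1"
proof -
  have three: "cycle_edges h 3 = {{h 0, h 1}, {h 1, h 2}, {h 2, h 0}}" for h :: "nat \<Rightarrow> 'v"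
  proof -
    have "{{h i, h (Suc i)} | i. Suc i < 3} = {{h 0, h 1}, {h 1, h 2}}"
    proof -
      have "Suc i < 3 \<longleftrightarrow> i = 0 \<or> i = 1" for i by auto
      then have "{{h i, h (Suc i)} | i. Suc i < 3} = {{h 0, h (Suc 0)}, {h 1, h (Suc 1)}}"
        by (simp only:) blast
      then show ?thesis by (simp add: numeral_2_eq_2)
    qed
    then show ?thesis by (simp add: cycle_edges_def insert_commute)
  qed
  have ne: "f i \<noteq> g j" for i j using fg by blast
  have base: "realization (join (cycle_edges f 3) (cycle_edges g 3)) homeomorphic sphere (0 :: real^4) 1"
    unfolding three using f(1) g(1) ne
    by (intro join_triangles_homeomorphic_sphere) (simp add: inj_eq)
  have "realization (join (cycle_edges f p) (cycle_edges g 3)) homeomorphic sphere (0 :: real^4) 1"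
    using f(2)
  proof (induction rule: dec_induct)
    case base show ?case by (rule \<open>realization (join (cycle_edges f 3) (cycle_edges g 3)) homeomorphic sphere (0 :: real^4) 1\<close>)
  next
    case (step m)
    show ?case
      using homeomorphic_trans[OF homeomorphic_sym[THEN iffD1, OF join_cycles_Suc[OF f(1) step(1) g(1) order_refl fg]] step(3)] .
  qed
  note p = this
  \<comment> \<open>The second cycle is lengthened in the same way, the join being
    symmetric.\<close>
  from g(2) show ?thesis
  proof (induction rule: dec_induct)
    case base show ?case by (rule p)
  next
    case (step m)
    have gf: "range g \<inter> range f = {}" using fg by blast
    have "realization (join (cycle_edges f p) (cycle_edges g m)) homeomorphic
        realization (join (cycle_edges f p) (cycle_edges g (Suc m)))"
      using join_cycles_Suc[OF g(1) step(1) f gf] by (simp only: join_commute[of "cycle_edges f p"])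
    then show ?case
      using step(3) by (metis homeomorphic_sym homeomorphic_trans)
  qed
qed

section \<open>Coning off a chain of tetrahedra\<close>

text \<open>
  For a sequence \<open>w\<close> of distinct vertices, the tetrahedra \<open>w l, w (l+1), w (l+2), w (l+3)\<close>, \<open>l < m\<close>,
  form a stacked ball; these are the index sets of its boundary triangles (for \<open>m \<ge> 1\<close>).
\<close>

definition chain_boundary :: "nat \<Rightarrow> nat set set"
  where "chain_boundary m = {{0..2}, {m..m+2}} \<union> {{l, l+1, l+3} | l. l < m} \<union> {{l, l+2, l+3} | l. l < m}"

definition cone_chain :: "'v set set \<Rightarrow> (nat \<Rightarrow> 'v) \<Rightarrow> 'v \<Rightarrow> nat \<Rightarrow> 'v set set"
  where "cone_chain T w r m = T - {w ` {l..l+3} | l. l < m} \<union> (\<lambda>I. insert r (w ` I)) ` chain_boundary m"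

lemma chain_boundary_bounded: "I \<in> chain_boundary m \<Longrightarrow> 1 \<le> m \<Longrightarrow> I \<subseteq> {..m + 2}"
  by (auto simp: chain_boundary_def)

lemma chain_boundary_card: "I \<in> chain_boundary m \<Longrightarrow> card I = 3"
  by (auto simp: chain_boundary_def)

lemma chain_boundary_subset: "I \<in> chain_boundary m \<Longrightarrow> 1 \<le> m \<Longrightarrow> \<exists>l<m. I \<subseteq> {l..l+3}"
proof -
  assume "I \<in> chain_boundary m" "1 \<le> m"
  then consider "I = {0..2}" | "I = {m..m+2}" | l where "l < m" "I = {l, l+1, l+3} \<or> I = {l, l+2, l+3}"
    by (auto simp: chain_boundary_def)
  then show ?thesis
  proof cases
    case 1 then show ?thesis using \<open>1 \<le> m\<close> by (intro exI[of _ 0]) auto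
  next
    case 2 then show ?thesis using \<open>1 \<le> m\<close> by (intro exI[of _ "m - 1"]) auto
  next
    case 3 then show ?thesis by (intro exI[of _ l]) auto
  qed
qed

text \<open>For a single tetrahedron the boundary index sets are the four complements of one index
  in \<open>{0..3}\<close>, so the cone is the stellar subdivision of a facet.\<close>

lemma cone_chain_1_homeomorphic:
  assumes card: "\<And>t. t \<in> T \<Longrightarrow> card t = 4"
    and inj: "inj_on w {..3}" and w: "w ` {0..3} \<in> T" and r: "r \<notin> \<Union>T"
  shows "realization T homeomorphic realization (cone_chain T w r 1)"
proof (rule bistellar_homeomorphic[where \<sigma> = "w ` {0..3}" and \<tau> = "{r}"])
  have card_w: "card (w ` {0..3}) = 4"
    using w card by blast
  have fin: "finite t" if "t \<in> T" for t
    using card[OF that] by (metis card.infinite zero_neq_numeral)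
  have eq: "t = w ` {0..3}" if "t \<in> T" "w ` {0..3} \<subseteq> t" for t
    using card_subset_eq[OF fin[OF that(1)] that(2)] card[OF that(1)] card_w by simp
  have r': "r \<notin> w ` {0..3}" using r w by blast
  have bd: "{0..3} - {i} \<in> chain_boundary 1" if "i \<in> {0..3}" for i :: nat
  proof -
    have "i = 0 \<or> i = 1 \<or> i = 2 \<or> i = 3" using that by auto
    moreover have "{0..3} - {0::nat} = {1..1+2}" "{0..3} - {1::nat} = {0, 0 + 2, 0 + 3}"
      "{0..3} - {2::nat} = {0, 0 + 1, 0 + 3}" "{0..3} - {3::nat} = {0..2}"
      by auto
    ultimately show ?thesis unfolding chain_boundary_def by fastforce
  qed
  have bd': "\<exists>i\<in>{0..3}. I = {0..3} - {i}" if "I \<in> chain_boundary 1" for I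
  proof -
    have "I = {0..2} \<or> I = {1..3} \<or> I = {0, 1, 3} \<or> I = {0, 2, 3}"
      using that by (auto simp: chain_boundary_def)
    moreover have "{0..3} - {0::nat} = {1..3}" "{0..3} - {1::nat} = {0, 2, 3}"
      "{0..3} - {2::nat} = {0, 1, 3}" "{0..3} - {3::nat} = {0..2}"
      by auto
    ultimately have "I = {0..3} - {3} \<or> I = {0..3} - {0} \<or> I = {0..3} - {2} \<or> I = {0..3} - {1}"
      by simp
    then show ?thesis by (elim disjE; intro bexI) (assumption | simp)+
  qed
  show "w ` {0..3} \<inter> {r} = {}" using r' by blast
  show "finite t" if "t \<in> T" for t by (rule fin[OF that])
  show "finite t" if "t \<in> cone_chain T w r 1" for t
    using that fin bd' by (auto simp: cone_chain_def)
  show "\<not> {r} \<subseteq> t" if "t \<in> T" for t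
    using that r by auto
  show "\<exists>t'\<in>cone_chain T w r 1. t - {s} \<union> {r} \<subseteq> t'"
    if t: "t \<in> T" "w ` {0..3} \<subseteq> t" and s: "s \<in> w ` {0..3}" for t s
  proof -
    obtain i where i: "i \<in> {0..3}" "s = w i" using s by blast
    then have "insert r (w ` ({0..3} - {i})) \<in> cone_chain T w r 1"
      using bd by (auto simp: cone_chain_def)
    moreover have "t - {s} \<union> {r} \<subseteq> insert r (w ` ({0..3} - {i}))"
      using eq[OF t] i by auto
    ultimately show ?thesis by blast
  qed
  show "\<exists>t'\<in>cone_chain T w r 1. t \<subseteq> t'" if "t \<in> T" "\<not> w ` {0..3} \<subseteq> t" for t
    using that by (intro bexI[of _ t]) (auto simp: cone_chain_def)
  show "\<not> w ` {0..3} \<subseteq> t" if t: "t \<in> cone_chain T w r 1" for t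
  proof
    assume sub: "w ` {0..3} \<subseteq> t"
    have "t \<notin> T - {w ` {l..l+3} | l. l < 1}" using eq[OF _ sub] by auto
    then obtain I where I: "I \<in> chain_boundary 1" "t = insert r (w ` I)"
      using t by (auto simp: cone_chain_def)
    then obtain i where i: "i \<in> {0..3}" "I = {0..3} - {i}" using bd' by blast
    have "w i \<notin> t"
      using I i r' inj by (auto simp: inj_on_def)
    then show False using sub i(1) by blast
  qed
  show "\<exists>t'\<in>T. t - {s} \<union> w ` {0..3} \<subseteq> t'"
    if t: "t \<in> cone_chain T w r 1" "{r} \<subseteq> t" and s: "s \<in> {r}" for t s
  proof -
    obtain I where "I \<in> chain_boundary 1" "t = insert r (w ` I)"
      using t r by (auto simp: cone_chain_def)
    then have "t - {s} \<union> w ` {0..3} \<subseteq> w ` {0..3}"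
      using bd'[of I] s by auto
    with w show ?thesis by blast
  qed
  show "\<exists>t'\<in>T. t \<subseteq> t'" if "t \<in> cone_chain T w r 1" "\<not> {r} \<subseteq> t" for t
    using that by (auto simp: cone_chain_def)
qed auto

text \<open>A 2-3 move: the glued triangle, on the indices m..m+2, lies in exactly two current
  facets, with opposite vertices \<open>r\<close> and \<open>w (m+3)\<close>. The hypothesis
  \<open>inner\<close> provides this, because of the two tetrahedra of \<open>T\<close> that it
  allows, the one on the indices m-1..m+2 is already coned off.\<close>

lemma cone_chain_Suc_homeomorphic:
  assumes card: "\<And>t. t \<in> T \<Longrightarrow> card t = 4"
    and inj: "inj_on w {..m+3}" and m: "1 \<le> m"
    and w: "w ` {m..m+3} \<in> T" and r: "r \<notin> \<Union>T"
    and rw: "r \<notin> w ` {..m+3}"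
    and inner: "\<And>t. t \<in> T \<Longrightarrow> w ` {m..m+2} \<subseteq> t \<Longrightarrow> t = w ` {m - 1..m+2} \<or> t = w ` {m..m+3}"
  shows "realization (cone_chain T w r m) homeomorphic realization (cone_chain T w r (Suc m))"
proof (rule bistellar_homeomorphic[where \<sigma> = "w ` {m..m+2}" and \<tau> = "{r, w (m+3)}"])
  have fin: "finite t" if "t \<in> T" for t
    using card[OF that] by (metis card.infinite zero_neq_numeral)
  have fin_bd: "finite I" if "I \<in> chain_boundary k" for I k
    using that by (auto simp: chain_boundary_def)
  have sub: "w ` I \<subseteq> w ` J \<longleftrightarrow> I \<subseteq> J" if "I \<subseteq> {..m+3}" "J \<subseteq> {..m+3}" for I J
    using inj_on_image_subset_iff[OF inj that] .
  have mem: "w i \<in> w ` J \<longleftrightarrow> i \<in> J" if "i \<le> m + 3" "J \<subseteq> {..m+3}" for i J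
    using inj_on_image_mem_iff[OF inj _ that(2)] that(1) by simp
  have r': "r \<noteq> w i" if "i \<le> m + 3" for i using rw that by auto
  have rJ: "r \<notin> w ` J" if "J \<subseteq> {..m+3}" for J
    using that rw by blast
  have bd_m3: "I \<subseteq> {..m+3}" if "I \<in> chain_boundary m" for I
    using chain_boundary_bounded[OF that m] by (rule order_trans) simp
  have bd_S3: "I \<subseteq> {..m+3}" if "I \<in> chain_boundary (Suc m)" for I
    using chain_boundary_bounded[OF that] by (simp add: eval_nat_numeral)
  have bd_m: "I \<subseteq> {..m+2}" if "I \<in> chain_boundary m" for I
    using chain_boundary_bounded[OF that m] .
  \<comment> \<open>Gluing on the next tetrahedron removes the glued triangle from the boundary and
    adds the three other triangles of that tetrahedron. As \<open>m\<close> is positive, the initial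
    triangle is not the glued one.\<close>
  have bd_Suc: "chain_boundary (Suc m) = chain_boundary m - {{m..m+2}} \<union> {{m+1..m+3}, {m, m+1, m+3}, {m, m+2, m+3}}"
  proof -
    have neq: "{0..2} \<noteq> {m..m+2}" using m by (metis Icc_eq_Icc add_cancel_left_left not_one_le_zero zero_le)
    have neq': "{l, l+1, l+3} \<noteq> {m..m+2}" "{l, l+2, l+3} \<noteq> {m..m+2}" if "l < m" for l
      using that by (metis atLeastAtMost_iff insertI1 not_le)+
    have lt: "{F l | l. l < Suc m} = insert (F m) {F l | l. l < m}" for F :: "nat \<Rightarrow> nat set"
      by (auto simp: less_Suc_eq)
    show ?thesis
      unfolding chain_boundary_def lt using neq neq' by (auto simp: eval_nat_numeral)
  qed
  have tri: "({m..m+2} - {i}) \<union> {m+3} \<in> chain_boundary (Suc m)" if "i \<in> {m..m+2}" for i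
  proof -
    consider "i = m" | "i = m + 1" | "i = m + 2" using \<open>i \<in> {m..m+2}\<close> by fastforce
    then have "({m..m+2} - {i}) \<union> {m+3} \<in> {{m+1..m+3}, {m, m+1, m+3}, {m, m+2, m+3}}"
    proof cases
      case 1
      then have "({m..m+2} - {i}) \<union> {m+3} = {m+1..m+3}" by auto
      then show ?thesis by blast
    next
      case 2
      then have "({m..m+2} - {i}) \<union> {m+3} = {m, m+2, m+3}" by auto
      then show ?thesis by blast
    next
      case 3
      then have "({m..m+2} - {i}) \<union> {m+3} = {m, m+1, m+3}" by auto
      then show ?thesis by blast
    qed
    then show ?thesis unfolding bd_Suc by blast
  qed
  have tri': "I \<subseteq> {m..m+3}" if "I \<in> chain_boundary (Suc m)" "m + 3 \<in> I" for I
  proof -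
    have "I \<notin> chain_boundary m" using bd_m[of I] subsetD[of I "{..m+2}" "m+3"] that(2) by auto
    then have "I = {m+1..m+3} \<or> I = {m, m+1, m+3} \<or> I = {m, m+2, m+3}"
      using that(1) unfolding bd_Suc by blast
    then show ?thesis by (elim disjE) simp_all
  qed
  have bd_eq: "I = {m..m+2}" if "I \<in> chain_boundary k" "{m..m+2} \<subseteq> I" for I k
    using card_subset_eq[OF fin_bd[OF that(1)] that(2)] chain_boundary_card[OF that(1)] by simp
  have notin: "{m..m+2} \<notin> chain_boundary (Suc m)"
  proof
    assume "{m..m+2} \<in> chain_boundary (Suc m)"
    then have "{m..m+2} = {m+1..m+3} \<or> {m..m+2} = {m, m+1, m+3} \<or> {m..m+2} = {m, m+2, m+3}"
      unfolding bd_Suc by blast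
    moreover have "m + 3 \<notin> {m..m+2}" "m + 3 \<in> {m+1..m+3}" by simp_all
    ultimately show False by blast
  qed
  show "w ` {m..m+2} \<inter> {r, w (m+3)} = {}"
  proof -
    have "{m..m+2} \<subseteq> {..m+3}" by auto
    then show ?thesis using mem[of "m+3" "{m..m+2}"] rJ[of "{m..m+2}"] by simp
  qed
  have fin_cone: "finite t" if "t \<in> cone_chain T w r k" for t k
    using that fin fin_bd by (auto simp: cone_chain_def)
  show "finite t" if "t \<in> cone_chain T w r m" for t by (rule fin_cone[OF that])
  show "finite t" if "t \<in> cone_chain T w r (Suc m)" for t by (rule fin_cone[OF that])
  show "\<not> {r, w (m+3)} \<subseteq> t" if t: "t \<in> cone_chain T w r m" for t
  proof
    assume s: "{r, w (m+3)} \<subseteq> t"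
    then obtain I where I: "I \<in> chain_boundary m" "t = insert r (w ` I)"
      using t r by (auto simp: cone_chain_def)
    then have "w (m+3) \<in> w ` I" using s r'[of "m+3"] by auto
    then show False using mem[of "m+3" I] bd_m3[OF I(1)] subsetD[OF bd_m[OF I(1)], of "m+3"] by auto
  qed
  show "\<exists>t'\<in>cone_chain T w r (Suc m). t - {s} \<union> {r, w (m+3)} \<subseteq> t'"
    if t: "t \<in> cone_chain T w r m" "w ` {m..m+2} \<subseteq> t" and s: "s \<in> w ` {m..m+2}" for t s
  proof -
    obtain i where i: "i \<in> {m..m+2}" "s = w i" using s by blast
    have "t = w ` {m..m+3} \<or> t = insert r (w ` {m..m+2})"
    proof (cases "t \<in> T - {w ` {l..l+3} | l. l < m}")
      case True
      then have "t \<noteq> w ` {m - 1..m+2}"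
        using m by (auto dest!: spec[of _ "m - 1"])
      then show ?thesis using inner[of t] t True by blast
    next
      case False
      then obtain I where I: "I \<in> chain_boundary m" "t = insert r (w ` I)"
        using t by (auto simp: cone_chain_def)
      have tri_le: "{m..m+2} \<subseteq> {..m+3}" by auto
      have "w ` {m..m+2} \<subseteq> w ` I" using t(2) I(2) rJ[OF tri_le] by blast
      then have "{m..m+2} \<subseteq> I" using sub[OF tri_le bd_m3[OF I(1)]] by simp
      then show ?thesis using bd_eq[OF I(1)] I(2) by simp
    qed
    moreover have "insert r (w ` (({m..m+2} - {i}) \<union> {m+3})) \<in> cone_chain T w r (Suc m)"
      unfolding cone_chain_def using tri[OF i(1)] by blast
    moreover have "w ` {m..m+3} - {s} \<union> {r, w (m+3)} \<subseteq> insert r (w ` (({m..m+2} - {i}) \<union> {m+3}))"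
    proof -
      have "{m..m+3} = {m..m+2} \<union> {m+3}" by auto
      then show ?thesis using i by auto
    qed
    moreover have "insert r (w ` {m..m+2}) - {s} \<union> {r, w (m+3)} \<subseteq> insert r (w ` (({m..m+2} - {i}) \<union> {m+3}))"
      using i by auto
    ultimately show ?thesis by blast
  qed
  show "\<exists>t'\<in>cone_chain T w r (Suc m). t \<subseteq> t'" if t: "t \<in> cone_chain T w r m" "\<not> w ` {m..m+2} \<subseteq> t" for t
  proof (cases "t \<in> T - {w ` {l..l+3} | l. l < m}")
    case True
    moreover have "t \<noteq> w ` {m..m+3}" using t(2) by auto
    ultimately have "t \<in> cone_chain T w r (Suc m)" by (auto simp: cone_chain_def less_Suc_eq)
    then show ?thesis by blast
  next
    case False
    then obtain I where I: "I \<in> chain_boundary m" "t = insert r (w ` I)"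
      using t by (auto simp: cone_chain_def)
    with t(2) have "I \<in> chain_boundary (Suc m)" by (auto simp: bd_Suc)
    with I have "t \<in> cone_chain T w r (Suc m)" by (auto simp: cone_chain_def)
    then show ?thesis by blast
  qed
  show "\<not> w ` {m..m+2} \<subseteq> t" if t: "t \<in> cone_chain T w r (Suc m)" for t
  proof
    assume s: "w ` {m..m+2} \<subseteq> t"
    show False
    proof (cases "t \<in> T - {w ` {l..l+3} | l. l < Suc m}")
      case True
      have neq: "t \<noteq> w ` {l..l+3}" if "l < Suc m" for l
        using True that by blast
      have "m - 1 + 3 = m + 2" using m by simp
      then have "t \<noteq> w ` {m - 1..m+2}" using neq[of "m - 1"] by simp
      moreover have "t \<noteq> w ` {m..m+3}" using neq[of m] by simp
      ultimately show False using inner s True by blast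
    next
      case False
      then obtain I where I: "I \<in> chain_boundary (Suc m)" "t = insert r (w ` I)"
        using t by (auto simp: cone_chain_def)
      have tri_le: "{m..m+2} \<subseteq> {..m+3}" by auto
      have "w ` {m..m+2} \<subseteq> w ` I" using s I(2) rJ[OF tri_le] by blast
      then have "{m..m+2} \<subseteq> I" using sub[OF tri_le bd_S3[OF I(1)]] by simp
      then show False using bd_eq[OF I(1)] I(1) notin by simp
    qed
  qed
  show "\<exists>t'\<in>cone_chain T w r m. t - {s} \<union> w ` {m..m+2} \<subseteq> t'"
    if t: "t \<in> cone_chain T w r (Suc m)" "{r, w (m+3)} \<subseteq> t" and s: "s \<in> {r, w (m+3)}" for t s
  proof -
    obtain I where I: "I \<in> chain_boundary (Suc m)" "t = insert r (w ` I)"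
      using t r by (auto simp: cone_chain_def)
    then have "w (m+3) \<in> w ` I" using t r'[of "m+3"] by auto
    then have "m + 3 \<in> I"
      using mem[of "m+3" I] bd_S3[OF I(1)] by simp
    then have t_sub: "t \<subseteq> insert r (w ` {m..m+3})" using I tri' by auto
    have split: "{m..m+3} = {m..m+2} \<union> {m+3}" by auto
    have "w ` {m..m+3} \<noteq> w ` {l..l+3}" if "l < m" for l
    proof
      assume "w ` {m..m+3} = w ` {l..l+3}"
      then have "w (m+3) \<in> w ` {l..l+3}" by auto
      then show False using mem[of "m+3" "{l..l+3}"] that by auto
    qed
    then have A: "w ` {m..m+3} \<in> cone_chain T w r m"
      using w by (auto simp: cone_chain_def)
    have B: "insert r (w ` {m..m+2}) \<in> cone_chain T w r m"
      unfolding cone_chain_def chain_boundary_def by blast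
    from s show ?thesis
    proof (elim insertE emptyE)
      assume "s = r"
      then have "t - {s} \<union> w ` {m..m+2} \<subseteq> w ` {m..m+3}" using t_sub split by auto
      with A show ?thesis by blast
    next
      assume "s = w (m+3)"
      then have "t - {s} \<union> w ` {m..m+2} \<subseteq> insert r (w ` {m..m+2})" using t_sub split by auto
      with B show ?thesis by blast
    qed
  qed
  show "\<exists>t'\<in>cone_chain T w r m. t \<subseteq> t'" if t: "t \<in> cone_chain T w r (Suc m)" "\<not> {r, w (m+3)} \<subseteq> t" for t
  proof (cases "t \<in> T - {w ` {l..l+3} | l. l < Suc m}")
    case True
    then have "t \<in> cone_chain T w r m" by (auto simp: cone_chain_def)
    then show ?thesis by blast
  next
    case False
    then obtain I where I: "I \<in> chain_boundary (Suc m)" "t = insert r (w ` I)"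
      using t by (auto simp: cone_chain_def)
    with t(2) have "m + 3 \<notin> I" by auto
    with I have "I \<in> chain_boundary m" by (auto simp: bd_Suc)
    with I have "t \<in> cone_chain T w r m" by (auto simp: cone_chain_def)
    then show ?thesis by blast
  qed
qed auto

text \<open>
  The first tetrahedron is subdivided at the new vertex \<open>r\<close>; each further tetrahedron is then
  absorbed into the cone by a bistellar move exchanging the triangle it is glued along and the
  edge from \<open>r\<close> to its last vertex.
\<close>

lemma cone_chain_homeomorphic:
  assumes card: "\<And>t. t \<in> T \<Longrightarrow> card t = 4"
    and inj: "inj_on w {..N+2}" and N: "1 \<le> N"
    and w: "\<And>l. l < N \<Longrightarrow> w ` {l..l+3} \<in> T" and r: "r \<notin> \<Union>T"
    and inner: "\<And>t m. t \<in> T \<Longrightarrow> 1 \<le> m \<Longrightarrow> m < N \<Longrightarrow> w ` {m..m+2} \<subseteq> t \<Longrightarrow>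
      t = w ` {m - 1..m+2} \<or> t = w ` {m..m+3}"
  shows "realization T homeomorphic realization (cone_chain T w r N)"
proof -
  have rw: "r \<notin> w ` {..N+2}"
  proof
    assume "r \<in> w ` {..N+2}"
    then obtain i where i: "i \<le> N + 2" "r = w i" by auto
    \<comment> \<open>The tetrahedron starting at index \<open>i\<close> or, near the end, the last
      one of the chain; in both cases it contains the index \<open>i\<close>.\<close>
    define l where "l = min i (N - 1)"
    have "l < N" "i \<in> {l..l+3}" using i N by (auto simp: l_def)
    then show False using w[of l] r i by blast
  qed
  have "m \<le> N \<Longrightarrow> realization T homeomorphic realization (cone_chain T w r m)" if "1 \<le> m" for m
    using that
  proof (induction rule: dec_induct)
    case base
    show ?case
      using w[of 0] N inj by (intro cone_chain_1_homeomorphic card r) (auto elim: inj_on_subset)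
  next
    case (step m)
    have "realization (cone_chain T w r m) homeomorphic realization (cone_chain T w r (Suc m))"
    proof (rule cone_chain_Suc_homeomorphic[OF card _ step(1) _ r])
      show "inj_on w {..m+3}" by (rule inj_on_subset[OF inj]) (use step in auto)
      show "w ` {m..m+3} \<in> T" using w step by simp
      show "r \<notin> w ` {..m+3}" using rw step by auto
      show "t = w ` {m - 1..m+2} \<or> t = w ` {m..m+3}" if "t \<in> T" "w ` {m..m+2} \<subseteq> t" for t
        using inner[OF that(1) step(1) _ that(2)] step by simp
    qed
    then show ?case using step homeomorphic_trans by auto
  qed
  then show ?thesis using N by blast
qed

section \<open>Simplices and bipyramids as polytopes\<close>

lemma geometric_simplex_mono:
  assumes "finite V" "U \<subseteq> V"
  shows "geometric_simplex U \<subseteq> geometric_simplex V"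
proof
  fix f assume "f \<in> geometric_simplex U"
  then show "f \<in> geometric_simplex V"
    using geometric_simplex_iff[OF assms(1,2), of f] geometric_simplex_iff[OF assms(1) subset_refl, of f] assms(2)
    by blast
qed

text \<open>Stated for any injective placement of the vertices, because it is applied both to
  simplices and to the five affinely dependent vertices of a bipyramid.\<close>

lemma image_geometric_simplex:
  fixes pos :: "'v \<Rightarrow> 'b::real_vector"
  assumes "finite V" "U \<subseteq> V" "inj_on pos V"
  shows "(\<lambda>f. \<Sum>v\<in>V. f v *\<^sub>R pos v) ` geometric_simplex U = convex hull (pos ` U)"
proof -
  have fU: "finite U" and inj: "inj_on pos U"
    using assms finite_subset inj_on_subset by blast+
  have sum_U: "(\<Sum>v\<in>V. f v *\<^sub>R pos v) = (\<Sum>v\<in>U. f v *\<^sub>R pos v)" if "f \<in> geometric_simplex U" for f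
    using that assms(1,2) by (intro sum.mono_neutral_right) (auto simp: geometric_simplex_def)
  show ?thesis
  proof (intro equalityI subsetI)
    fix z assume "z \<in> (\<lambda>f. \<Sum>v\<in>V. f v *\<^sub>R pos v) ` geometric_simplex U"
    then obtain f where f: "f \<in> geometric_simplex U" "z = (\<Sum>v\<in>U. f v *\<^sub>R pos v)"
      using sum_U by auto
    define u where "u = (\<lambda>b. f (the_inv_into U pos b))"
    have u: "u (pos v) = f v" if "v \<in> U" for v
      using that inj by (simp add: u_def the_inv_into_f_f)
    have "\<forall>b\<in>pos ` U. 0 \<le> u b" "sum u (pos ` U) = 1" "(\<Sum>b\<in>pos ` U. u b *\<^sub>R b) = z"
      using f u by (auto simp: sum.reindex[OF inj] geometric_simplex_def)
    then show "z \<in> convex hull (pos ` U)"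
      unfolding convex_hull_finite[OF finite_imageI[OF fU]] by blast
  next
    fix z assume "z \<in> convex hull (pos ` U)"
    then obtain u where u: "\<forall>b\<in>pos ` U. 0 \<le> u b" "sum u (pos ` U) = 1" "(\<Sum>b\<in>pos ` U. u b *\<^sub>R b) = z"
      unfolding convex_hull_finite[OF finite_imageI[OF fU]] by blast
    define f where "f v = (if v \<in> U then u (pos v) else 0)" for v
    have f: "f \<in> geometric_simplex U"
      using u by (auto simp: geometric_simplex_def f_def sum.reindex[OF inj])
    moreover have "(\<Sum>v\<in>U. f v *\<^sub>R pos v) = z"
      using u(3) by (simp add: f_def sum.reindex[OF inj])
    ultimately show "z \<in> (\<lambda>f. \<Sum>v\<in>V. f v *\<^sub>R pos v) ` geometric_simplex U"
      using f sum_U[OF f] by (intro image_eqI[of _ _ f]) simp_all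
  qed
qed

text \<open>Faces are computed as images under the barycentric map \<open>g\<close>, whereas a
  complex describes them as images under its chart \<open>h\<close>; this converts one description
  into the other.\<close>

lemma homeomorphism_faces:
  assumes hom: "homeomorphism P S h g"
    and faces: "{F. F face_of P} = (`) g ` \<F>" and sub: "\<And>A. A \<in> \<F> \<Longrightarrow> A \<subseteq> S"
  shows "{h ` F | F. F face_of P} = \<F>"
proof -
  have "h ` g ` A = A" if "A \<in> \<F>" for A
    using sub[OF that] homeomorphism_apply2[OF hom] by (force simp: image_image)
  then have "(`) h ` (`) g ` \<F> = \<F>"
    by (force simp: image_image)
  moreover have "{h ` F | F. F face_of P} = (`) h ` {F. F face_of P}" by blast
  ultimately show ?thesis using faces by simp
qed

lemma continuous_on_barycentric:
  fixes pos :: "'v \<Rightarrow> 'b::real_normed_vector"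
  shows "continuous_on S (\<lambda>f. \<Sum>v\<in>V. f v *\<^sub>R pos v)"
  by (intro continuous_intros continuous_on_product_then_coordinatewise[OF continuous_on_id])

text \<open>The origin and the standard basis are four affinely independent points of 3-space,
  enough for every face of a tetrahedron. The faces of their hull correspond to sets of vertices,
  the empty one included.\<close>

lemma geometric_simplex_polytope:
  fixes V :: "'v set"
  assumes "finite V" "card V \<le> 4"
  obtains P :: "(real^3) set" and h g where "polytope P" "aff_dim P = int (card V) - 1"
    "homeomorphism P (geometric_simplex V) h g"
    "{h ` F | F. F face_of P} = geometric_simplex ` Pow V"
proof -
  define B :: "(real^3) set" where "B = insert 0 Basis"
  \<comment> \<open>The form that translating the base point 0 to the origin takes in
    \<open>affine_dependent_iff_dependent\<close>.\<close>
  have "(\<lambda>x :: real^3. - 0 + x) ` Basis = Basis" by simp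
  then have indep: "\<not> affine_dependent B"
    unfolding B_def using affine_dependent_iff_dependent[of "0 :: real^3" Basis] independent_Basis
    by (simp add: nonzero_Basis)
  have "finite B" "card B = 4"
    by (auto simp: B_def nonzero_Basis)
  then obtain pos where pos: "pos ` V \<subseteq> B" "inj_on pos V"
    using card_le_inj[of V B] assms by auto
  have ind: "\<not> affine_dependent (pos ` V)"
    using affine_independent_subset[OF indep pos(1)] .
  define g where "g f = (\<Sum>v\<in>V. f v *\<^sub>R pos v)" for f
  define P where "P = convex hull (pos ` V)"
  have g_im: "g ` geometric_simplex U = convex hull (pos ` U)" if "U \<subseteq> V" for U
    using image_geometric_simplex[OF assms(1) that pos(2)] by (simp add: g_def)
  have inj: "inj_on g (geometric_simplex V)"
  proof (rule inj_onI)
    fix f f' assume f: "f \<in> geometric_simplex V" "f' \<in> geometric_simplex V" "g f = g f'"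
    define u where "u = (\<lambda>b. f (the_inv_into V pos b) - f' (the_inv_into V pos b))"
    have u: "u (pos v) = f v - f' v" if "v \<in> V" for v
      using that pos(2) by (simp add: u_def the_inv_into_f_f)
    have "sum u (pos ` V) = 0"
      using f u by (simp add: sum.reindex[OF pos(2)] geometric_simplex_def sum_subtractf)
    moreover have "(\<Sum>b\<in>pos ` V. u b *\<^sub>R b) = 0"
      using f(3) u by (simp add: sum.reindex[OF pos(2)] g_def scaleR_diff_left sum_subtractf)
    ultimately have "\<forall>b\<in>pos ` V. u b = 0"
      using ind affine_dependent_explicit_finite[of "pos ` V"] assms(1) by blast
    then have "f v = f' v" if "v \<in> V" for v
      using u that by simp
    moreover have "f v = f' v" if "v \<notin> V" for v
      using f that by (simp add: geometric_simplex_def)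
    ultimately show "f = f'" by blast
  qed
  obtain h where hom: "homeomorphism (geometric_simplex V) P g h"
    using homeomorphism_compact[OF compact_geometric_simplex[OF assms(1)] _ _ inj, of P]
      g_im[of V] continuous_on_barycentric[of "geometric_simplex V" pos V] by (auto simp: P_def g_def)
  have faces: "{F. F face_of P} = (`) g ` geometric_simplex ` Pow V"
  proof -
    have "{F. F face_of P} = {convex hull c | c. c \<subseteq> pos ` V}"
      unfolding P_def using face_of_convex_hull_affine_independent[OF ind] by auto
    also have "\<dots> = {convex hull (pos ` U) | U. U \<subseteq> V}"
      by (metis (no_types) subset_image_iff)
    also have "\<dots> = (\<lambda>U. g ` geometric_simplex U) ` Pow V"
      using g_im by (auto simp: image_def)
    finally show ?thesis by (simp add: image_image)
  qed
  have mono: "geometric_simplex U \<subseteq> geometric_simplex V" if "U \<subseteq> V" for U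
    using geometric_simplex_mono[OF assms(1) that] .
  show ?thesis
  proof
    show "polytope P" using assms(1) by (simp add: P_def polytope_convex_hull)
    show "aff_dim P = int (card V) - 1"
      using aff_dim_affine_independent[OF ind] card_image[OF pos(2)] by (simp add: P_def aff_dim_convex_hull)
    show "homeomorphism P (geometric_simplex V) h g" using hom homeomorphism_symD by blast
    then show "{h ` F | F. F face_of P} = geometric_simplex ` Pow V"
      by (rule homeomorphism_faces[OF _ faces]) (use mono in auto)
  qed
qed

text \<open>Apices on the third axis, base triangle in the plane of the first two. The last branch
  is the position of \<open>r\<close>, and a default for vertices outside the five.\<close>

definition bipyramid_pos :: "'v \<Rightarrow> 'v \<Rightarrow> 'v \<Rightarrow> 'v \<Rightarrow> 'v \<Rightarrow> real^3"
  where "bipyramid_pos x y p q v = (if v = x then axis 3 1 else if v = y then - axis 3 1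
    else if v = p then axis 1 1 else if v = q then axis 2 1 else - axis 1 1 - axis 2 1)"

text \<open>
  \<open>S\<close> is the union of the three tetrahedra around the edge \<open>x y\<close>. In the model the midpoint of the
  axis and the barycentre of \<open>p q r\<close> are both the origin, and any face containing the origin is
  the whole bipyramid.
\<close>

lemma axis_star_bipyramid:
  fixes x y p q r :: 'v
  assumes dist: "distinct [x, y, p, q, r]"
  defines "V \<equiv> {x, y, p, q, r}"
  defines "S \<equiv> {f \<in> geometric_simplex V. f p = 0 \<or> f q = 0 \<or> f r = 0}"
  obtains P :: "(real^3) set" and h g where "bipyramid P" "homeomorphism P S h g"
    "{h ` F | F. F face_of P} =
      insert S (geometric_simplex ` {U. U \<subseteq> V \<and> \<not> {x, y} \<subseteq> U \<and> \<not> {p, q, r} \<subseteq> U})"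
proof -
  have ne: "x \<noteq> y" "x \<noteq> p" "x \<noteq> q" "x \<noteq> r" "y \<noteq> p" "y \<noteq> q" "y \<noteq> r" "p \<noteq> q" "p \<noteq> r" "q \<noteq> r"
    "y \<noteq> x" "p \<noteq> x" "q \<noteq> x" "r \<noteq> x" "p \<noteq> y" "q \<noteq> y" "r \<noteq> y" "q \<noteq> p" "r \<noteq> p" "r \<noteq> q"
    using dist by auto
  have finV: "finite V" by (simp add: V_def)
  have sumV: "sum F V = F x + F y + F p + F q + F r" for F :: "'v \<Rightarrow> real"
    using ne by (simp add: V_def)
  have sumV3: "sum F V = F x + F y + F p + F q + F r" for F :: "'v \<Rightarrow> real^3"
    using ne by (simp add: V_def)
  define pos where "pos = bipyramid_pos x y p q"
  have pos: "pos x = axis 3 1" "pos y = - axis 3 1" "pos p = axis 1 1" "pos q = axis 2 1"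
    "pos r = - axis 1 1 - axis 2 1"
    using ne by (simp_all add: pos_def bipyramid_pos_def)
  define g where "g f = (\<Sum>v\<in>V. f v *\<^sub>R pos v)" for f
  have g_nth: "g f $ 1 = f p - f r" "g f $ 2 = f q - f r" "g f $ 3 = f x - f y" for f
    unfolding g_def sumV3 by (simp_all add: pos axis_def)
  \<comment> \<open>Up to scale the five positions satisfy one affine relation, with weights 3 on
    the apices and -2 on the base. On \<open>V\<close>, weight functions with the same total and the
    same image differ by a multiple of it.\<close>
  have ker: "f p - f' p = f r - f' r" "f q - f' q = f r - f' r" "f x - f' x = f y - f' y"
      "3 * (f r - f' r) + 2 * (f y - f' y) = 0"
    if "g f = g f'" "sum f V = sum f' V" for f f' :: "'v \<Rightarrow> real"
  proof -
    have "g f $ 1 = g f' $ 1" "g f $ 2 = g f' $ 2" "g f $ 3 = g f' $ 3"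
      using that(1) by simp_all
    then have d: "f p - f r = f' p - f' r" "f q - f r = f' q - f' r" "f x - f y = f' x - f' y"
      unfolding g_nth .
    have s: "f x + f y + f p + f q + f r = f' x + f' y + f' p + f' q + f' r"
      using that(2) unfolding sumV .
    show "f p - f' p = f r - f' r" "f q - f' q = f r - f' r" "f x - f' x = f y - f' y"
      using d by linarith+
    show "3 * (f r - f' r) + 2 * (f y - f' y) = 0"
      using d s by (simp add: algebra_simps)
  qed
  have inj_pos: "inj_on pos V"
  proof -
    have n: "pos x $ 3 = 1" "pos x $ 1 = 0" "pos x $ 2 = 0" "pos y $ 3 = -1" "pos y $ 1 = 0" "pos y $ 2 = 0"
      "pos p $ 1 = 1" "pos p $ 2 = 0" "pos p $ 3 = 0" "pos q $ 1 = 0" "pos q $ 2 = 1" "pos q $ 3 = 0"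
      "pos r $ 1 = -1" "pos r $ 2 = -1" "pos r $ 3 = 0"
      by (simp_all add: pos axis_def)
    have "u = v" if "u \<in> V" "v \<in> V" "pos u = pos v" for u v
    proof -
      have "pos u $ 1 = pos v $ 1" "pos u $ 2 = pos v $ 2" "pos u $ 3 = pos v $ 3"
        using that(3) by simp_all
      with that(1,2) n show ?thesis
        unfolding V_def by (elim insertE emptyE) simp_all
    qed
    then show ?thesis by (rule inj_onI)
  qed
  define P where "P = convex hull (pos ` V)"
  have g_im: "g ` geometric_simplex U = convex hull (pos ` U)" if "U \<subseteq> V" for U
    using image_geometric_simplex[OF finV that inj_pos] by (simp add: g_def)
  have gs: "f \<in> geometric_simplex U \<longleftrightarrow> (\<forall>v. 0 \<le> f v) \<and> (\<forall>v. v \<notin> U \<longrightarrow> f v = 0) \<and> sum f V = 1"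
    if "U \<subseteq> V" for U f
    using geometric_simplex_iff[OF finV that] .
  have S_sub: "S \<subseteq> geometric_simplex V" by (auto simp: S_def)
  have g_S: "g ` S = P"
  proof (intro equalityI subsetI)
    fix z assume "z \<in> g ` S"
    then show "z \<in> P" using S_sub g_im[of V] by (auto simp: P_def)
  next
    fix z assume "z \<in> P"
    then obtain f where f: "f \<in> geometric_simplex V" "z = g f"
      using g_im[of V] by (auto simp: P_def)
    \<comment> \<open>Moving along the affine relation until a base coordinate vanishes reaches a
      point of \<open>S\<close> with the same image. Three base vertices lose \<open>m\<close> each,
      so each apex gains 3/2 times \<open>m\<close>.\<close>
    define m where "m = min (f p) (min (f q) (f r))"
    define f' where "f' v = (if v = x \<or> v = y then f v + 3/2 * m else if v = p \<or> v = q \<or> v = r then f v - m else 0)" for v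
    have f0: "0 \<le> f v" for v using f(1) by (simp add: geometric_simplex_def)
    have m: "0 \<le> m" "m \<le> f p" "m \<le> f q" "m \<le> f r" "m = f p \<or> m = f q \<or> m = f r"
      using f0 by (auto simp: m_def)
    have f'v: "f' x = f x + 3/2 * m" "f' y = f y + 3/2 * m" "f' p = f p - m" "f' q = f q - m" "f' r = f r - m"
      using ne by (simp_all add: f'_def)
    have "sum f' V = 1"
      using f(1) gs[of V f] by (simp add: sumV f'v)
    moreover have "0 \<le> f' v" for v
      using m f0[of v] by (auto simp: f'_def)
    moreover have "f' v = 0" if "v \<notin> V" for v
      using that by (auto simp: f'_def V_def)
    ultimately have "f' \<in> geometric_simplex V" using gs[of V f'] by simp
    then have "f' \<in> S" using m(5) by (auto simp: S_def f'v)
    moreover have "g f' = g f"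
      by (simp add: vec_eq_iff forall_3 g_nth f'v)
    ultimately show "z \<in> g ` S" using f(2) by (metis image_eqI)
  qed
  have inj_S: "inj_on g S"
  proof (rule inj_onI)
    fix f f' assume f: "f \<in> S" "f' \<in> S" "g f = g f'"
    have *: "sum f V = 1" "sum f' V = 1" "\<And>v. 0 \<le> f v" "\<And>v. 0 \<le> f' v"
      "\<And>v. v \<notin> V \<Longrightarrow> f v = 0" "\<And>v. v \<notin> V \<Longrightarrow> f' v = 0"
      using f gs[of V f] gs[of V f'] by (auto simp: S_def)
    have z: "f p = 0 \<or> f q = 0 \<or> f r = 0" "f' p = 0 \<or> f' q = 0 \<or> f' r = 0"
      using f by (auto simp: S_def)
    have k: "f p - f' p = f r - f' r" "f q - f' q = f r - f' r" "f x - f' x = f y - f' y"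
      "3 * (f r - f' r) + 2 * (f y - f' y) = 0"
      using ker[OF f(3)] *(1,2) by simp_all
    \<comment> \<open>The difference is the same at all three base vertices. Were it nonzero, one of
      the two functions would be positive on the whole base, contrary to membership in
      \<open>S\<close>.\<close>
    have "f r - f' r = 0"
      using z k *(3)[of p] *(3)[of q] *(3)[of r] *(4)[of p] *(4)[of q] *(4)[of r] by linarith
    moreover from this k(4) have "f y - f' y = 0" by simp
    ultimately have "f x = f' x" "f y = f' y" "f p = f' p" "f q = f' q" "f r = f' r"
      using k(1-3) by simp_all
    then have "f v = f' v" if "v \<in> V" for v using that by (auto simp: V_def)
    moreover have "f v = f' v" if "v \<notin> V" for v using that *(5,6) by simp
    ultimately show "f = f'" by blast
  qed
  have comp_S: "compact S"
  proof -
    have cl: "closed {f :: 'v \<Rightarrow> real. f v = 0}" for v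
      by (intro closed_Collect_eq continuous_intros continuous_on_product_then_coordinatewise[OF continuous_on_id])
    have "S = geometric_simplex V \<inter> ({f. f p = 0} \<union> {f. f q = 0} \<union> {f. f r = 0})"
      by (auto simp: S_def)
    then show ?thesis
      by (simp only:) (intro compact_Int_closed compact_geometric_simplex finV closed_Un cl)
  qed
  obtain h where hom: "homeomorphism S P g h"
    using homeomorphism_compact[OF comp_S _ g_S inj_S] continuous_on_barycentric[of S pos V]
    by (auto simp: g_def)
  define \<U> where "\<U> = {U. U \<subseteq> V \<and> \<not> {x, y} \<subseteq> U \<and> \<not> {p, q, r} \<subseteq> U}"
  have gs_S: "geometric_simplex U \<subseteq> S" if "U \<in> \<U>" for U
    using that gs[of U] gs[of V] unfolding \<U>_def S_def by blast
  \<comment> \<open>The set \<open>U\<close> misses an apex and a base vertex, where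
    \<open>e\<close> is nonnegative. As \<open>e\<close> is constant on the apices and constant on
    the base, with opposite signs by the affine relation, it must vanish. Independence of the
    vertices of a face and the face property itself both reduce to this.\<close>
  have ker0: "e v = 0" if e: "e p = e r" "e q = e r" "e x = e y" "3 * e r + 2 * e y = 0" and v: "v \<in> V"
    and U: "U \<in> \<U>" "\<And>v. v \<notin> U \<Longrightarrow> 0 \<le> e v" for e :: "'v \<Rightarrow> real" and U v
  proof -
    have "0 \<le> e x \<or> 0 \<le> e y" "0 \<le> e p \<or> 0 \<le> e q \<or> 0 \<le> e r"
      using U by (auto simp: \<U>_def)
    then have "e r = 0" using e by linarith
    moreover from this have "e y = 0" using e(4) by simp
    ultimately have "e r = 0" "e y = 0" by simp_all
    then show ?thesis using e v by (auto simp: V_def)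
  qed
  have indep: "\<not> affine_dependent (pos ` U)" if U: "U \<in> \<U>" for U
  proof
    assume dep: "affine_dependent (pos ` U)"
    have UV: "U \<subseteq> V" "finite U" using U finV finite_subset by (auto simp: \<U>_def)
    have inj: "inj_on pos U" using inj_pos UV inj_on_subset by blast
    obtain u v where u: "sum u (pos ` U) = 0" "v \<in> U" "u (pos v) \<noteq> 0" "(\<Sum>b\<in>pos ` U. u b *\<^sub>R b) = 0"
      using dep UV affine_dependent_explicit_finite[of "pos ` U"] by auto
    define e where "e w = (if w \<in> U then u (pos w) else 0)" for w
    have "sum e V = sum e U" using UV finV by (intro sum.mono_neutral_right) (auto simp: e_def)
    also have "\<dots> = 0" using u(1) by (simp add: e_def sum.reindex[OF inj])
    finally have s: "sum e V = sum (\<lambda>_. 0) V" by simp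
    have "g e = (\<Sum>w\<in>U. e w *\<^sub>R pos w)"
      unfolding g_def using UV finV by (intro sum.mono_neutral_right) (auto simp: e_def)
    also have "\<dots> = 0" using u(4) by (simp add: e_def sum.reindex[OF inj])
    finally have gz: "g e = g (\<lambda>_. 0)" by (simp add: g_def)
    have "e v = 0"
      by (rule ker0[OF _ _ _ _ _ U]) (use ker[OF gz s] u(2) UV in \<open>auto simp: e_def\<close>)
    then show False using u by (simp add: e_def)
  qed
  have P_conv: "convex P" by (simp add: P_def)
  have zero_face: "F = P" if F: "F face_of P" "0 \<in> F" for F
  proof -
    have FP: "F \<subseteq> P" "convex F" using F face_of_imp_subset face_of_imp_convex by blast+
    have inP: "pos v \<in> P" if "v \<in> V" for v
      using that hull_inc[of "pos v" "pos ` V"] by (simp add: P_def)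
    have mid: "(1/2) *\<^sub>R a + (1/2) *\<^sub>R b \<in> P" if "a \<in> P" "b \<in> P" for a b
      using that P_conv by (intro convexD) auto
    have key: "a \<in> F" if "a \<in> P" "b \<in> P" "a \<noteq> 0" "0 = (1 - t) *\<^sub>R a + t *\<^sub>R b" "0 < t" "t < 1" for a b t
    proof -
      have "a \<noteq> b"
      proof
        assume "a = b"
        then have "(1 - t) *\<^sub>R a + t *\<^sub>R b = a" by (simp flip: scaleR_add_left)
        then show False using that(3,4) by simp
      qed
      then have "0 \<in> open_segment a b" using that unfolding in_segment by blast
      then show ?thesis using F that(1,2) unfolding face_of_def by blast
    qed
    have V: "x \<in> V" "y \<in> V" "p \<in> V" "q \<in> V" "r \<in> V" by (auto simp: V_def)
    have nz: "pos x \<noteq> 0" "pos y \<noteq> 0" "pos p \<noteq> 0" "pos q \<noteq> 0" "pos r \<noteq> 0"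
      by (simp_all add: pos vec_eq_iff forall_3 axis_def)
    \<comment> \<open>Every vertex is an endpoint of a segment with the origin in its interior:
      opposite an apex lies the other apex, with parameter 1/2; opposite a base vertex lies the
      midpoint of the other two, with parameter 2/3, the origin being the centroid.\<close>
    have z: "0 = (1 - 1/2) *\<^sub>R pos x + (1/2) *\<^sub>R pos y" "0 = (1 - 1/2) *\<^sub>R pos y + (1/2) *\<^sub>R pos x"
      "0 = (1 - 2/3) *\<^sub>R pos p + (2/3) *\<^sub>R ((1/2) *\<^sub>R pos q + (1/2) *\<^sub>R pos r)"
      "0 = (1 - 2/3) *\<^sub>R pos q + (2/3) *\<^sub>R ((1/2) *\<^sub>R pos p + (1/2) *\<^sub>R pos r)"
      "0 = (1 - 2/3) *\<^sub>R pos r + (2/3) *\<^sub>R ((1/2) *\<^sub>R pos p + (1/2) *\<^sub>R pos q)"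
      by (simp_all add: pos vec_eq_iff forall_3 axis_def)
    note P = V[THEN inP]
    have "pos x \<in> F" "pos y \<in> F" "pos p \<in> F" "pos q \<in> F" "pos r \<in> F"
      using key[OF P(1) P(2) nz(1) z(1)] key[OF P(2) P(1) nz(2) z(2)]
        key[OF P(3) mid[OF P(4,5)] nz(3) z(3)] key[OF P(4) mid[OF P(3,5)] nz(4) z(4)]
        key[OF P(5) mid[OF P(3,4)] nz(5) z(5)] by simp_all
    then have "pos ` V \<subseteq> F" by (auto simp: V_def)
    then have "P \<subseteq> F" unfolding P_def using FP(2) by (rule hull_minimal)
    then show ?thesis using FP(1) by blast
  qed
  have face_cases: "F = P \<or> (\<exists>U\<in>\<U>. F = convex hull (pos ` U))" if F: "F face_of P" for F
  proof -
    obtain c where "c \<subseteq> pos ` V" "F = convex hull c"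
      using face_of_convex_hull_subset[of "pos ` V" F] F finV by (auto simp: P_def finite_imp_compact)
    then obtain U where U: "U \<subseteq> V" "F = convex hull (pos ` U)"
      by (metis subset_image_iff)
    have inF: "pos v \<in> F" if "v \<in> U" for v
      using that hull_inc[of "pos v" "pos ` U"] by (simp add: U)
    have cF: "convex F" by (simp add: U)
    show ?thesis
    proof (cases "U \<in> \<U>")
      case True then show ?thesis using U by blast
    next
      case False
      then consider "{x, y} \<subseteq> U" | "{p, q, r} \<subseteq> U" using U by (auto simp: \<U>_def)
      then have "0 \<in> F"
      proof cases
        case 1
        then have "(1/2) *\<^sub>R pos x + (1/2) *\<^sub>R pos y \<in> F"
          using inF by (intro convexD[OF cF]) auto
        then show ?thesis by (simp add: pos)
      next
        case 2
        then have "(1/2) *\<^sub>R pos p + (1/2) *\<^sub>R pos q \<in> F" "pos r \<in> F"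
          using inF by (auto intro!: convexD[OF cF])
        then have "(2/3) *\<^sub>R ((1/2) *\<^sub>R pos p + (1/2) *\<^sub>R pos q) + (1/3) *\<^sub>R pos r \<in> F"
          by (rule convexD[OF cF]) auto
        also have "(2/3) *\<^sub>R ((1/2) *\<^sub>R pos p + (1/2) *\<^sub>R pos q) + (1/3) *\<^sub>R pos r = 0"
          by (simp add: pos vec_eq_iff forall_3 axis_def)
        finally show ?thesis .
      qed
      then show ?thesis using zero_face F by blast
    qed
  qed
  have face_U: "convex hull (pos ` U) face_of P" if U: "U \<in> \<U>" for U
  proof -
    have UV: "U \<subseteq> V" using U by (simp add: \<U>_def)
    have both: "a \<in> convex hull (pos ` U) \<and> b \<in> convex hull (pos ` U)"
      if ab: "a \<in> P" "b \<in> P" "z \<in> convex hull (pos ` U)" "z \<in> open_segment a b" for a b z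
    proof -
      have "a \<in> g ` geometric_simplex V" "b \<in> g ` geometric_simplex V" "z \<in> g ` geometric_simplex U"
        using ab(1-3) g_im[of V] g_im[OF UV] by (simp_all add: P_def)
      then obtain fa fb fz where f: "fa \<in> geometric_simplex V" "a = g fa" "fb \<in> geometric_simplex V" "b = g fb"
        "fz \<in> geometric_simplex U" "z = g fz"
        by blast
      obtain t where t: "0 < t" "t < 1" "z = (1 - t) *\<^sub>R a + t *\<^sub>R b"
        using ab(4) unfolding in_segment by blast
      define c where "c v = (1 - t) * fa v + t * fb v" for v
      have c: "g c = g fz"
      proof -
        have "g c = (1 - t) *\<^sub>R g fa + t *\<^sub>R g fb"
          unfolding g_def c_def by (simp only: scaleR_sum_right sum.distrib scaleR_add_left scaleR_scaleR)
        then show ?thesis using t(3) f(2,4,6) by simp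
      qed
      have fs: "sum fa V = 1" "sum fb V = 1" "sum fz V = 1" "\<And>v. 0 \<le> fa v" "\<And>v. 0 \<le> fb v" "\<And>v. v \<notin> U \<Longrightarrow> fz v = 0"
        "\<And>v. v \<notin> V \<Longrightarrow> fa v = 0" "\<And>v. v \<notin> V \<Longrightarrow> fb v = 0"
        using f(1,3,5) gs[of V] gs[OF UV] by auto
      have "sum c V = (1 - t) * sum fa V + t * sum fb V"
        by (simp add: c_def sum.distrib sum_distrib_left)
      then have s: "sum c V = sum fz V" using fs by simp
      have c0: "0 \<le> c v" for v using t fs by (simp add: c_def)
      \<comment> \<open>Off \<open>U\<close> the function \<open>fz\<close> vanishes and
        \<open>c\<close> is nonnegative, so \<open>ker0\<close> applies. Hence \<open>c\<close> is
        supported on \<open>U\<close>, and with it both nonnegative functions that it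
        combines.\<close>
      have "c v - fz v = 0" if "v \<in> V" for v
        by (rule ker0[where e = "\<lambda>v. c v - fz v", OF _ _ _ _ that U]) (use ker[OF c s] c0 fs in auto)
      then have "c v = 0" if "v \<notin> U" for v
        using that fs(6-8) by (cases "v \<in> V") (auto simp: c_def)
      moreover have "fa v = 0 \<and> fb v = 0" if "c v = 0" for v
      proof -
        have "0 \<le> (1 - t) * fa v" "0 \<le> t * fb v" using t fs by simp_all
        with that have "(1 - t) * fa v = 0" "t * fb v = 0" unfolding c_def by linarith+
        then show ?thesis using t by simp
      qed
      ultimately have "fa \<in> geometric_simplex U" "fb \<in> geometric_simplex U"
        using fs gs[OF UV] by auto
      then show ?thesis using f g_im[OF UV] by blast
    qed
    show ?thesis
      unfolding face_of_def
    proof (intro conjI ballI impI)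
      show "convex hull (pos ` U) \<subseteq> P" unfolding P_def by (intro hull_mono image_mono UV)
    qed (use both in \<open>blast+ | simp\<close>)
  qed
  have faces: "{F. F face_of P} = (`) g ` insert S (geometric_simplex ` \<U>)"
  proof -
    have im: "(`) g ` insert S (geometric_simplex ` \<U>) = insert P ((\<lambda>U. convex hull (pos ` U)) ` \<U>)"
    proof -
      have "(`) g ` geometric_simplex ` \<U> = (\<lambda>U. g ` geometric_simplex U) ` \<U>" by (rule image_image)
      also have "\<dots> = (\<lambda>U. convex hull (pos ` U)) ` \<U>"
        by (intro image_cong refl g_im) (simp add: \<U>_def)
      finally show ?thesis by (simp only: image_insert g_S)
    qed
    show ?thesis
      unfolding im using face_cases face_U face_of_refl[OF P_conv] by blast
  qed
  show ?thesis
  proof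
    show hom': "homeomorphism P S h g" using hom homeomorphism_symD by blast
    show "{h ` F | F. F face_of P} =
      insert S (geometric_simplex ` {U. U \<subseteq> V \<and> \<not> {x, y} \<subseteq> U \<and> \<not> {p, q, r} \<subseteq> U})"
      unfolding \<U>_def[symmetric] by (rule homeomorphism_faces[OF hom' faces]) (use gs_S in blast)
    show "bipyramid P"
      unfolding bipyramid_def
    proof (intro conjI allI impI)
      show "polytope P" using finV by (simp add: P_def polytope_convex_hull)
      have V: "x \<in> V" "y \<in> V" "p \<in> V" "q \<in> V" "r \<in> V" by (auto simp: V_def)
      have "{} \<in> \<U>" and sing: "{v} \<in> \<U>" if "v \<in> V" for v
        using that ne by (auto simp: \<U>_def)
      have P_not_sing: "P \<noteq> {a}" for a
      proof
        assume "P = {a}"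
        then have "pos x = a" "pos y = a"
          using V hull_inc[of _ "pos ` V" convex] by (auto simp: P_def)
        then show False using inj_pos V ne(1) by (auto dest: inj_onD)
      qed
      have "{v. v extreme_point_of P} = pos ` V"
      proof (intro equalityI subsetI)
        fix a assume "a \<in> {v. v extreme_point_of P}"
        then have "{a} face_of P" by (simp add: face_of_singleton)
        then obtain U where U: "U \<in> \<U>" "{a} = convex hull (pos ` U)"
          using face_cases P_not_sing by blast
        then obtain v where "v \<in> U" by fastforce
        then have "pos v = a" using hull_inc[of "pos v" "pos ` U" convex] U(2) by auto
        then show "a \<in> pos ` V" using \<open>v \<in> U\<close> U(1) by (auto simp: \<U>_def)
      next
        fix a assume "a \<in> pos ` V"
        then obtain v where "v \<in> V" "a = pos v" by blast
        then show "a \<in> {v. v extreme_point_of P}"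
          using face_U[OF sing[of v]] by (simp add: face_of_singleton)
      qed
      moreover have "card V = 5" using ne by (simp add: V_def)
      ultimately show "card {v. v extreme_point_of P} = 5"
        using card_image[OF inj_pos] by simp
      have posP: "pos v \<in> affine hull P" if "v \<in> V" for v
        using that hull_inc[of "pos v" "pos ` V" convex] hull_inc[of "pos v" P affine] by (simp add: P_def)
      have "(1/2) *\<^sub>R pos x + (1/2) *\<^sub>R pos y \<in> affine hull P"
        by (intro mem_affine[OF affine_affine_hull] posP V) simp
      then have "0 \<in> affine hull P" by (simp add: pos)
      then have aff0: "affine hull P = span P" using affine_hull_span_0 by blast
      have "Basis \<subseteq> span P"
      proof
        fix b :: "real^3" assume "b \<in> Basis"
        then obtain i where "b = axis i 1" by (auto simp: Basis_vec_def)
        moreover have "i = 1 \<or> i = 2 \<or> i = 3" using exhaust_3[of i] by blast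
        moreover have "axis 3 1 \<in> span P" "axis 1 1 \<in> span P" "axis 2 1 \<in> span P"
          using posP[OF V(1)] posP[OF V(3)] posP[OF V(4)] unfolding aff0 pos .
        ultimately show "b \<in> span P" by auto
      qed
      then have "span (Basis :: (real^3) set) \<subseteq> span P" by (rule span_minimal[OF _ subspace_span])
      then have "span P = UNIV" by auto
      then show dimP: "aff_dim P = 3" using aff_dim_eq_full[of P] aff0 by simp
      fix F assume F: "F facet_of P"
      then have "F face_of P" "F \<noteq> {}" "aff_dim F = 2" using dimP by (auto simp: facet_of_def)
      then obtain U where U: "U \<in> \<U>" "F = convex hull (pos ` U)"
        using face_cases[of F] dimP by auto
      have "int (card (pos ` U)) = 2 + 1"
        using aff_dim_affine_independent[OF indep[OF U(1)]] \<open>aff_dim F = 2\<close> U(2) by (simp add: aff_dim_convex_hull)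
      then show "2 simplex F"
        unfolding simplex_def using indep[OF U(1)] U(2) by blast
    qed
  qed
qed

section \<open>Merging the stars of edges of degree three\<close>

lemma homeomorphism_imp_homeomorphic_map:
  assumes "homeomorphism S T f g"
  shows "homeomorphic_map (top_of_set S) (top_of_set T) f"
  unfolding homeomorphic_map_maps homeomorphic_maps_def
  using assms by (intro exI[of _ g]) (auto simp: homeomorphism_def)

lemma bipyramid_aff_dim: "bipyramid B \<Longrightarrow> aff_dim B = 3"
  by (simp add: bipyramid_def)

text \<open>
  The three tetrahedra around each of the edges \<open>x i y i\<close> of degree three are merged into a
  bipyramid. All cells, merged or not, are the sets of points of the realization supported on a
  given set of vertices, so that intersecting cells amounts to intersecting vertex sets.
\<close>

lemma polyhedral_sphere_of_triangulation:
  fixes T :: "'v set set" and I :: "'i set" and x y p q r :: "'i \<Rightarrow> 'v"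
  assumes finT: "finite T" and card: "\<And>t. t \<in> T \<Longrightarrow> card t = 4"
    and sphere: "realization T homeomorphic sphere (0 :: real^4) 1"
    and finI: "finite I"
    and dist: "\<And>i. i \<in> I \<Longrightarrow> distinct [x i, y i, p i, q i, r i]"
    and tets: "\<And>i. i \<in> I \<Longrightarrow> {x i, y i, p i, q i} \<in> T \<and> {x i, y i, q i, r i} \<in> T \<and> {x i, y i, p i, r i} \<in> T"
    and base: "\<And>i t. i \<in> I \<Longrightarrow> t \<in> T \<Longrightarrow> \<not> {p i, q i, r i} \<subseteq> t"
    and base_inj: "\<And>i j. i \<in> I \<Longrightarrow> j \<in> I \<Longrightarrow> {p i, q i, r i} = {p j, q j, r j} \<Longrightarrow> i = j"
    and star: "\<And>i t. i \<in> I \<Longrightarrow> t \<in> T \<Longrightarrow> {x i, y i} \<subseteq> t \<Longrightarrow> t \<subseteq> {x i, y i, p i, q i, r i}"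
    and disj: "\<And>i j t. i \<in> I \<Longrightarrow> j \<in> I \<Longrightarrow> t \<in> T \<Longrightarrow> {x i, y i} \<subseteq> t \<Longrightarrow> {x j, y j} \<subseteq> t \<Longrightarrow> i = j"
  shows "\<exists>(X :: (real^4) topology) K P h. polyhedral_3_sphere X K P h \<and>
    card (cells_of_dim K P 0) = card (\<Union>T) \<and>
    (\<exists>S \<subseteq> cells_of_dim K P 3. card S = card I \<and> (\<forall>C\<in>S. bipyramid (P C)))"
proof -
  have fin: "finite t" if "t \<in> T" for t
    using card[OF that] by (metis card.infinite zero_neq_numeral)
  have finU: "finite (\<Union>T)" using finT fin by blast
  have ne: "x i \<noteq> y i" "x i \<noteq> p i" "x i \<noteq> q i" "x i \<noteq> r i" "y i \<noteq> p i" "y i \<noteq> q i" "y i \<noteq> r i"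
    "p i \<noteq> q i" "p i \<noteq> r i" "q i \<noteq> r i" if "i \<in> I" for i
    using dist[OF that] by auto
  \<comment> \<open>Axis, base triangle and vertex set of the star number \<open>i\<close>; the
    facets of the star omit one base vertex each.\<close>
  define E where "E i = {x i, y i}" for i
  define F where "F i = {p i, q i, r i}" for i
  define W where "W i = {x i, y i, p i, q i, r i}" for i
  have EW: "E i \<subseteq> W i" for i by (auto simp: E_def W_def)
  have tet: "W i - {v} \<in> T" if "i \<in> I" "v \<in> F i" for i v
  proof -
    have "W i - {p i} = {x i, y i, q i, r i}" "W i - {q i} = {x i, y i, p i, r i}"
      "W i - {r i} = {x i, y i, p i, q i}"
      using ne[OF that(1)] by (auto simp: W_def)
    moreover have "v = p i \<or> v = q i \<or> v = r i" using that(2) by (simp add: F_def)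
    ultimately show ?thesis using tets[OF that(1)] by (elim disjE) (simp_all only:)
  qed
  have face_W: "\<exists>t\<in>T. U \<subseteq> t" if iU: "i \<in> I" "U \<subseteq> W i" "\<not> F i \<subseteq> U" for i U
  proof -
    obtain v where "v \<in> F i" "v \<notin> U" using iU(3) by blast
    then have "U \<subseteq> W i - {v}" "W i - {v} \<in> T" using iU(2) tet[OF iU(1)] by auto
    then show ?thesis by (intro bexI)
  qed
  \<comment> \<open>An axis has only two vertices, so it misses some base vertex \<open>v\<close> of
    star \<open>j\<close>. The facet \<open>W j - {v}\<close> then contains both axes, contrary to
    \<open>disj\<close> unless they agree.\<close>
  have E_W: "k = j" if kj: "k \<in> I" "j \<in> I" "E k \<subseteq> W j" for k j
  proof -
    obtain v where v: "v \<in> F j" "v \<notin> E k"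
    proof -
      have "\<not> F j \<subseteq> E k"
      proof
        assume "F j \<subseteq> E k"
        then have "card (F j) \<le> card (E k)" by (intro card_mono) (auto simp: E_def)
        moreover have "card (F j) = 3" using ne[OF kj(2)] by (simp add: F_def)
        moreover have "card (E k) \<le> 2" by (simp add: E_def card_insert_if)
        ultimately show False by simp
      qed
      then show ?thesis using that by blast
    qed
    have "E k \<subseteq> W j - {v}" "E j \<subseteq> W j - {v}"
      using kj v ne[OF kj(2)] by (auto simp: E_def W_def F_def)
    then show ?thesis
      using disj[OF kj(1,2) tet[OF kj(2) v(1)]] by (simp add: E_def)
  qed
  \<comment> \<open>A base triangle inside \<open>W j\<close> other than \<open>F j\<close> would be
    a face of the triangulation by \<open>face_W\<close>, which \<open>base\<close> forbids.\<close>
  have F_W: "k = j" if "k \<in> I" "j \<in> I" "F k \<subseteq> W j" for k j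
  proof (rule ccontr)
    assume "k \<noteq> j"
    then have "F k \<noteq> F j" using base_inj[OF that(1,2)] by (auto simp: F_def)
    moreover have "card (F k) = card (F j)" using ne[OF that(1)] ne[OF that(2)] by (simp add: F_def)
    ultimately have "\<not> F j \<subseteq> F k"
      using card_subset_eq[of "F k" "F j"] by (auto simp: F_def)
    then have "\<exists>t\<in>T. F k \<subseteq> t" by (rule face_W[OF that(2,3)])
    then show False using base[OF that(1)] unfolding F_def by blast
  qed
  \<comment> \<open>The faces that remain simplicial cells after merging. The empty face is one of
    them and gives the empty cell, since weights on it cannot sum to 1.\<close>
  define axis_free where "axis_free \<sigma> \<longleftrightarrow> (\<exists>t\<in>T. \<sigma> \<subseteq> t) \<and> (\<forall>i\<in>I. \<not> E i \<subseteq> \<sigma>)" for \<sigma>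
  define \<V> where "\<V> = {\<sigma>. axis_free \<sigma>} \<union> W ` I"
  define cell where "cell V = {f \<in> realization T. \<forall>v. v \<notin> V \<longrightarrow> f v = 0}" for V
  have axis_free_mono: "axis_free \<tau>" if "axis_free \<sigma>" "\<tau> \<subseteq> \<sigma>" for \<sigma> \<tau>
    using that unfolding axis_free_def by (meson subset_trans)
  \<comment> \<open>Within a star, the remaining faces are thus exactly the proper faces of the
    bipyramid found in \<open>axis_star_bipyramid\<close>; the axes of other stars are ruled out by
    \<open>E_W\<close>.\<close>
  have axis_free_W: "axis_free U \<longleftrightarrow> \<not> E i \<subseteq> U \<and> \<not> F i \<subseteq> U" if i: "i \<in> I" and U: "U \<subseteq> W i" for i U
  proof
    assume "axis_free U"
    then show "\<not> E i \<subseteq> U \<and> \<not> F i \<subseteq> U"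
      using base[OF i] i unfolding axis_free_def F_def by (meson subset_trans)
  next
    assume U': "\<not> E i \<subseteq> U \<and> \<not> F i \<subseteq> U"
    have "\<not> E k \<subseteq> U" if k: "k \<in> I" for k
    proof
      assume "E k \<subseteq> U"
      moreover from this U have "E k \<subseteq> W i" by (rule subset_trans)
      then have "k = i" by (rule E_W[OF k i])
      ultimately show False using U' by simp
    qed
    then show "axis_free U"
      using face_W[OF i U] U' unfolding axis_free_def by simp
  qed
  have not_axis_free_W: "\<not> axis_free (W i)" if "i \<in> I" for i
    using EW[of i] that unfolding axis_free_def by blast
  have Int: "V \<inter> V' \<in> \<V>" if "V \<in> \<V>" "V' \<in> \<V>" for V V'
  proof -
    consider "axis_free V" | "axis_free V'" | i j where "i \<in> I" "j \<in> I" "V = W i" "V' = W j"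
      using \<open>V \<in> \<V>\<close> \<open>V' \<in> \<V>\<close> by (auto simp: \<V>_def)
    then show ?thesis
    proof cases
      case 1 then show ?thesis using axis_free_mono by (simp add: \<V>_def)
    next
      case 2 then show ?thesis using axis_free_mono by (simp add: \<V>_def)
    next
      case 3
      show ?thesis
      proof (cases "i = j")
        case True then show ?thesis using 3 by (simp add: \<V>_def)
      next
        case False
        \<comment> \<open>The common vertices of two bipyramids contain neither the axis nor the
          base of the first one, so they span a proper face of it. Being axis-free, this is also a
          proper face of the second one.\<close>
        then have "axis_free (V \<inter> V')"
          using axis_free_W[of i "V \<inter> V'"] E_W[of i j] F_W[of i j] 3 by auto
        then show ?thesis by (simp add: \<V>_def)
      qed
    qed
  qed
  have cell_Int: "cell V \<inter> cell V' = cell (V \<inter> V')" for V V'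
    by (auto simp: cell_def)
  have gs: "f \<in> geometric_simplex s \<longleftrightarrow> (\<forall>v. 0 \<le> f v) \<and> (\<forall>v. v \<notin> s \<longrightarrow> f v = 0) \<and> sum f (\<Union>T) = 1"
    if "s \<subseteq> \<Union>T" for f s
    using geometric_simplex_iff[OF finU that] .
  have cell_axis_free: "cell \<sigma> = geometric_simplex \<sigma>" if \<sigma>: "axis_free \<sigma>" for \<sigma>
  proof -
    obtain t where t: "t \<in> T" "\<sigma> \<subseteq> t" using \<sigma> by (auto simp: axis_free_def)
    then have s: "\<sigma> \<subseteq> \<Union>T" by blast
    show ?thesis
    proof (intro equalityI subsetI)
      fix f assume "f \<in> cell \<sigma>"
      then obtain t' where t': "t' \<in> T" "f \<in> geometric_simplex t'" "\<forall>v. v \<notin> \<sigma> \<longrightarrow> f v = 0"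
        by (auto simp: cell_def realization_def)
      have "t' \<subseteq> \<Union>T" using t'(1) by blast
      then show "f \<in> geometric_simplex \<sigma>" using t' gs[of t' f] gs[OF s, of f] by simp
    next
      fix f assume f: "f \<in> geometric_simplex \<sigma>"
      then have "f \<in> geometric_simplex t" using geometric_simplex_mono[OF fin[OF t(1)] t(2)] by blast
      then show "f \<in> cell \<sigma>" using t f by (auto simp: cell_def realization_def geometric_simplex_def)
    qed
  qed
  have W_sub: "W i \<subseteq> \<Union>T" if "i \<in> I" for i
  proof -
    have "W i = {x i, y i, p i, q i} \<union> {x i, y i, q i, r i}" by (auto simp: W_def)
    then show ?thesis using tets[OF that] by (simp only:) (intro Un_least Union_upper; simp only:)
  qed
  have cell_W: "cell (W i) = {f \<in> geometric_simplex (W i). f (p i) = 0 \<or> f (q i) = 0 \<or> f (r i) = 0}"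
    if i: "i \<in> I" for i
  proof (intro equalityI subsetI)
    fix f assume "f \<in> cell (W i)"
    then obtain t' where t': "t' \<in> T" "f \<in> geometric_simplex t'" "\<forall>v. v \<notin> W i \<longrightarrow> f v = 0"
      by (auto simp: cell_def realization_def)
    have "t' \<subseteq> \<Union>T" using t'(1) by blast
    then have f: "f \<in> geometric_simplex (W i)" "\<forall>v. v \<notin> t' \<longrightarrow> f v = 0"
      using t' gs[of t' f] gs[OF W_sub[OF i], of f] by simp_all
    have "p i \<notin> t' \<or> q i \<notin> t' \<or> r i \<notin> t'" using base[OF i t'(1)] by auto
    then show "f \<in> {f \<in> geometric_simplex (W i). f (p i) = 0 \<or> f (q i) = 0 \<or> f (r i) = 0}"
      using f by blast
  next
    fix f assume f: "f \<in> {f \<in> geometric_simplex (W i). f (p i) = 0 \<or> f (q i) = 0 \<or> f (r i) = 0}"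
    then obtain v where v: "v \<in> F i" "f v = 0" by (auto simp: F_def)
    have t: "W i - {v} \<in> T" by (rule tet[OF i v(1)])
    have "W i - {v} \<subseteq> \<Union>T" using t by blast
    then have "f \<in> geometric_simplex (W i - {v})"
      using f v(2) gs[of "W i - {v}" f] gs[OF W_sub[OF i], of f] by auto
    then have "f \<in> realization T" using t unfolding realization_def by blast
    moreover have "\<forall>v. v \<notin> W i \<longrightarrow> f v = 0" using f by (simp add: geometric_simplex_def)
    ultimately show "f \<in> cell (W i)" by (simp add: cell_def)
  qed
  have card_axis_free: "card V \<le> 4" "finite V" if "axis_free V" for V
  proof -
    from that obtain t where "t \<in> T" "V \<subseteq> t" unfolding axis_free_def by blast
    then show "card V \<le> 4" "finite V"
      using card_mono[OF fin[of t], of V] card[of t] finite_subset[OF _ fin[of t]] by simp_all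
  qed
  have sub_axis_free: "{U \<in> \<V>. U \<subseteq> V} = Pow V" if "axis_free V" for V
    using axis_free_mono[OF that] not_axis_free_W unfolding \<V>_def by blast
  have sub_W: "{U \<in> \<V>. U \<subseteq> W i} = insert (W i) {U. U \<subseteq> W i \<and> \<not> {x i, y i} \<subseteq> U \<and> \<not> {p i, q i, r i} \<subseteq> U}"
    if i: "i \<in> I" for i
  proof -
    have "U = W i" if "U \<in> W ` I" "U \<subseteq> W i" for U
    proof -
      obtain k where k: "k \<in> I" "U = W k" using \<open>U \<in> W ` I\<close> by blast
      then have "E k \<subseteq> W i" using EW[of k] \<open>U \<subseteq> W i\<close> by simp
      then show ?thesis using E_W[OF k(1) i] k(2) by simp
    qed
    then have "{U \<in> \<V>. U \<subseteq> W i} = insert (W i) {U. U \<subseteq> W i \<and> axis_free U}"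
      using i unfolding \<V>_def by blast
    also have "\<dots> = insert (W i) {U. U \<subseteq> W i \<and> \<not> E i \<subseteq> U \<and> \<not> F i \<subseteq> U}"
      using axis_free_W[OF i] by blast
    finally show ?thesis unfolding E_def F_def .
  qed
  \<comment> \<open>Polytope, chart and inverse are bundled into one predicate so that a single
    choice fixes all three for every vertex set.\<close>
  define model where "model V P h g \<longleftrightarrow> polytope P \<and> homeomorphism P (cell V) h g \<and>
      {h ` F | F. F face_of P} = cell ` {U \<in> \<V>. U \<subseteq> V} \<and>
      (axis_free V \<longrightarrow> aff_dim P = int (card V) - 1) \<and> (V \<in> W ` I \<longrightarrow> bipyramid P)"
    for V and P :: "(real^3) set" and h g
  have "\<exists>P h g. model V P h g" if V: "V \<in> \<V>" for V
  proof (cases "axis_free V")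
    case True
    obtain P :: "(real^3) set" and h g where P: "polytope P" "aff_dim P = int (card V) - 1"
      "homeomorphism P (geometric_simplex V) h g" "{h ` F | F. F face_of P} = geometric_simplex ` Pow V"
      using geometric_simplex_polytope[OF card_axis_free(2)[OF True] card_axis_free(1)[OF True]] by blast
    have "geometric_simplex ` Pow V = cell ` {U \<in> \<V>. U \<subseteq> V}"
      unfolding sub_axis_free[OF True] using axis_free_mono[OF True] cell_axis_free by (intro image_cong) auto
    moreover have "V \<notin> W ` I" using True not_axis_free_W by blast
    ultimately have "model V P h g" using P cell_axis_free[OF True] by (simp add: model_def)
    then show ?thesis by blast
  next
    case False
    then obtain i where i: "i \<in> I" "V = W i" using V by (auto simp: \<V>_def)
    obtain P :: "(real^3) set" and h g where P: "bipyramid P"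
      "homeomorphism P {f \<in> geometric_simplex (W i). f (p i) = 0 \<or> f (q i) = 0 \<or> f (r i) = 0} h g"
      "{h ` F | F. F face_of P} = insert {f \<in> geometric_simplex (W i). f (p i) = 0 \<or> f (q i) = 0 \<or> f (r i) = 0}
        (geometric_simplex ` {U. U \<subseteq> W i \<and> \<not> {x i, y i} \<subseteq> U \<and> \<not> {p i, q i, r i} \<subseteq> U})"
      using axis_star_bipyramid[OF dist[OF i(1)]] unfolding W_def by blast
    have "geometric_simplex ` {U. U \<subseteq> W i \<and> \<not> {x i, y i} \<subseteq> U \<and> \<not> {p i, q i, r i} \<subseteq> U} =
        cell ` {U. U \<subseteq> W i \<and> \<not> {x i, y i} \<subseteq> U \<and> \<not> {p i, q i, r i} \<subseteq> U}"
      using cell_axis_free axis_free_W[OF i(1)] by (intro image_cong) (auto simp: E_def F_def)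
    then have "{h ` F | F. F face_of P} = cell ` {U \<in> \<V>. U \<subseteq> V}"
      unfolding i(2) sub_W[OF i(1)] P(3) by (simp add: cell_W[OF i(1)])
    then have "model V P h g"
      using P(1,2) False i cell_W[OF i(1)] by (simp add: model_def bipyramid_def)
    then show ?thesis by blast
  qed
  then obtain P0 h0 g0 where model: "\<And>V. V \<in> \<V> \<Longrightarrow> model V (P0 V) (h0 V) (g0 V)"
    by metis
  have P0: "polytope (P0 V)" "homeomorphism (P0 V) (cell V) (h0 V) (g0 V)"
    "{h0 V ` F | F. F face_of P0 V} = cell ` {U \<in> \<V>. U \<subseteq> V}" if "V \<in> \<V>" for V
    using model[OF that] by (simp_all add: model_def)
  have aff_dim_P0: "aff_dim (P0 V) = int (card V) - 1" if "axis_free V" for V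
    using model[of V] that by (simp add: model_def \<V>_def)
  have bip_P0: "bipyramid (P0 (W i))" if "i \<in> I" for i
    using model[of "W i"] that by (simp add: model_def \<V>_def)
  \<comment> \<open>The space of the complex is the unit sphere itself, and the cells are carried
    over to it by \<phi>.\<close>
  obtain \<phi> \<psi> where hom: "homeomorphism (realization T) (sphere (0 :: real^4) 1) \<phi> \<psi>"
    using sphere by (auto simp: homeomorphic_def)
  have cell_sub: "cell V \<subseteq> realization T" for V by (auto simp: cell_def)
  have \<psi>\<phi>: "\<psi> ` \<phi> ` cell V = cell V" for V
  proof -
    have "\<psi> (\<phi> f) = f" if "f \<in> cell V" for f
      using that cell_sub homeomorphism_apply1[OF hom] by blast
    then show ?thesis by (force simp: image_image)
  qed
  have vertex: "f v \<noteq> 0 \<longrightarrow> v \<in> V" if "f \<in> cell V" for f v V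
    using that by (auto simp: cell_def)
  have delta: "(\<lambda>w. if w = v then 1 else 0) \<in> cell V" if V: "v \<in> V" "V \<subseteq> \<Union>T" for v V
  proof -
    obtain t where t: "t \<in> T" "v \<in> t" using V by blast
    then have "(\<lambda>w. if w = v then 1 else 0) \<in> geometric_simplex t"
      using fin[OF t(1)] by (auto simp: geometric_simplex_def)
    then show ?thesis using t V by (auto simp: cell_def realization_def)
  qed
  have \<V>_sub: "V \<subseteq> \<Union>T" if "V \<in> \<V>" for V
    using that W_sub by (auto simp: \<V>_def axis_free_def)
  \<comment> \<open>In a complex, polytope and chart are functions of the cell, a subset of the
    sphere. The vertex set of a cell is therefore read off as the union of the supports of its
    points.\<close>
  define code where "code C = {v. \<exists>f\<in>\<psi> ` C. f v \<noteq> 0}" for C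
  define c where "c V = \<phi> ` cell V" for V
  have code_c: "code (c V) = V" if "V \<in> \<V>" for V
  proof
    show "code (c V) \<subseteq> V" unfolding code_def c_def \<psi>\<phi> using vertex by blast
    show "V \<subseteq> code (c V)"
    proof
      fix v assume "v \<in> V"
      then show "v \<in> code (c V)"
        unfolding code_def c_def \<psi>\<phi> using delta[OF _ \<V>_sub[OF that]]
        by (auto intro!: bexI[of _ "\<lambda>w. if w = v then 1 else 0"])
    qed
  qed
  have inj_c: "inj_on c \<V>" by (rule inj_on_inverseI[of _ code]) (rule code_c)
  define K where "K = c ` \<V>"
  define P where "P C = P0 (code C)" for C
  define h where "h C = \<phi> \<circ> h0 (code C)" for C
  have P_c: "P (c V) = P0 V" "h (c V) = \<phi> \<circ> h0 V" if "V \<in> \<V>" for V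
    using code_c[OF that] by (simp_all add: P_def h_def)
  have hom_c: "homeomorphism (P0 V) (c V) (\<phi> \<circ> h0 V) (g0 V \<circ> \<psi>)" if "V \<in> \<V>" for V
  proof (rule homeomorphism_compose[OF P0(2)[OF that]])
    show "homeomorphism (cell V) (c V) \<phi> \<psi>"
      using homeomorphism_of_subsets[OF hom cell_sub] homeomorphism_image1[OF hom] cell_sub
      by (auto simp: c_def)
  qed
  have c_sub: "c V \<subseteq> sphere 0 1" for V
    using homeomorphism_image1[OF hom] cell_sub by (auto simp: c_def)
  have faces_c: "cell_faces P h (c V) = c ` {U \<in> \<V>. U \<subseteq> V}" if "V \<in> \<V>" for V
  proof -
    have "cell_faces P h (c V) = (`) \<phi> ` {h0 V ` F | F. F face_of P0 V}"
      unfolding cell_faces_def P_c[OF that] by (simp only: image_comp[symmetric]) blast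
    also have "\<dots> = c ` {U \<in> \<V>. U \<subseteq> V}"
      unfolding P0(3)[OF that] by (auto simp: c_def image_image)
    finally show ?thesis .
  qed
  have c_Int: "c V \<inter> c V' = c (V \<inter> V')" for V V'
  proof -
    have "inj_on \<phi> (realization T)"
      using homeomorphism_apply1[OF hom] by (rule inj_on_inverseI)
    then have "\<phi> ` cell V \<inter> \<phi> ` cell V' = \<phi> ` (cell V \<inter> cell V')"
      using cell_sub by (metis inj_on_image_Int)
    then show ?thesis by (simp add: c_def cell_Int)
  qed
  have complex: "polyhedral_complex (top_of_set (sphere 0 1)) K P h"
    unfolding polyhedral_complex_def
  proof (intro conjI ballI)
    have "\<V> \<subseteq> Pow (\<Union>T)" using \<V>_sub by blast
    then have "finite \<V>" using finU by (metis finite_Pow_iff finite_subset)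
    then show "finite K" by (simp add: K_def)
    have "realization T \<subseteq> \<Union>(cell ` \<V>)"
    proof
      fix f assume f: "f \<in> realization T"
      then obtain t where t: "t \<in> T" "f \<in> geometric_simplex t" by (auto simp: realization_def)
      show "f \<in> \<Union>(cell ` \<V>)"
      proof (cases "axis_free t")
        case True
        then show ?thesis using t cell_axis_free[OF True] by (auto simp: \<V>_def)
      next
        case False
        then obtain i where "i \<in> I" "E i \<subseteq> t" using t(1) by (auto simp: axis_free_def)
        then have "t \<subseteq> W i" using star[OF _ t(1)] by (simp add: E_def W_def)
        then have "f \<in> cell (W i)" using t f by (auto simp: cell_def geometric_simplex_def)
        then show ?thesis using \<open>i \<in> I\<close> by (auto simp: \<V>_def)
      qed
    qed
    then have "\<Union>(cell ` \<V>) = realization T" using cell_sub by blast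
    moreover have "\<Union>K = \<phi> ` \<Union>(cell ` \<V>)" unfolding K_def c_def by blast
    ultimately show "\<Union>K = topspace (top_of_set (sphere 0 1))" using homeomorphism_image1[OF hom] by simp
  next
    fix C assume "C \<in> K"
    then obtain V where V: "V \<in> \<V>" "C = c V" by (auto simp: K_def)
    show "polytope (P C)" using P0(1)[OF V(1)] V by (simp add: P_c)
    have "compact (P0 V)" using P0(1)[OF V(1)] polytope_imp_compact by blast
    then have "compact C"
      using homeomorphism_cont1[OF hom_c[OF V(1)]] homeomorphism_image1[OF hom_c[OF V(1)]] V(2)
      by (metis compact_continuous_image)
    then show "closedin (top_of_set (sphere 0 1)) C"
      using c_sub[of V] V(2) by (simp add: closed_subset compact_imp_closed)
    have "subtopology (top_of_set (sphere 0 1)) C = top_of_set C"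
      using c_sub[of V] V(2) by (simp add: subtopology_subtopology Int_absorb1)
    then show "homeomorphic_map (top_of_set (P C)) (subtopology (top_of_set (sphere 0 1)) C) (h C)"
      using homeomorphism_imp_homeomorphic_map[OF hom_c[OF V(1)]] V by (simp add: P_c)
    show "cell_faces P h C \<subseteq> K" using faces_c[OF V(1)] V(2) by (auto simp: K_def)
  next
    fix C D assume "C \<in> K" "D \<in> K"
    then obtain V V' where V: "V \<in> \<V>" "C = c V" "V' \<in> \<V>" "D = c V'" by (auto simp: K_def)
    have "V \<inter> V' \<in> {U \<in> \<V>. U \<subseteq> V}" "V \<inter> V' \<in> {U \<in> \<V>. U \<subseteq> V'}"
      using Int[OF V(1,3)] by auto
    then show "C \<inter> D \<in> cell_faces P h C" "C \<inter> D \<in> cell_faces P h D"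
      using V c_Int[of V V'] faces_c by auto
  qed
  have sing: "axis_free {v}" if "v \<in> \<Union>T" for v
  proof -
    have "\<not> E i \<subseteq> {v}" if "i \<in> I" for i
      using ne(1)[OF that] by (auto simp: E_def)
    then show ?thesis using that by (simp add: axis_free_def)
  qed
  have "cells_of_dim K P 0 = c ` (\<lambda>v. {v}) ` \<Union>T"
  proof (intro equalityI subsetI)
    fix C assume "C \<in> cells_of_dim K P 0"
    then obtain V where V: "V \<in> \<V>" "C = c V" "aff_dim (P0 V) = 0"
      by (auto simp: cells_of_dim_def K_def P_c)
    have "V \<noteq> W i" if "i \<in> I" for i
      using bipyramid_aff_dim[OF bip_P0[OF that]] V(3) by auto
    then have "V \<notin> W ` I" by blast
    then have "axis_free V" using V(1) by (auto simp: \<V>_def)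
    then have "card V = 1" using aff_dim_P0[of V] V(3) by simp
    then show "C \<in> c ` (\<lambda>v. {v}) ` \<Union>T"
      using \<V>_sub[OF V(1)] V(2) by (auto simp: card_1_singleton_iff)
  next
    fix C assume "C \<in> c ` (\<lambda>v. {v}) ` \<Union>T"
    then obtain v where v: "v \<in> \<Union>T" "C = c {v}" by blast
    have "{v} \<in> \<V>" using sing[OF v(1)] by (simp add: \<V>_def)
    then show "C \<in> cells_of_dim K P 0"
      using v(2) aff_dim_P0[OF sing[OF v(1)]] by (simp add: cells_of_dim_def K_def P_c)
  qed
  moreover have "inj_on (\<lambda>v. c {v}) (\<Union>T)"
  proof (rule inj_onI)
    fix u v assume "u \<in> \<Union>T" "v \<in> \<Union>T" "c {u} = c {v}"
    moreover from this sing have "{u} \<in> \<V>" "{v} \<in> \<V>" unfolding \<V>_def by blast+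
    ultimately show "u = v" using inj_onD[OF inj_c] by blast
  qed
  ultimately have card0: "card (cells_of_dim K P 0) = card (\<Union>T)"
    by (simp only: image_image card_image)
  define S where "S = (\<lambda>i. c (W i)) ` I"
  have W_\<V>: "W i \<in> \<V>" if "i \<in> I" for i using that by (simp add: \<V>_def)
  have "inj_on (\<lambda>i. c (W i)) I"
  proof (rule inj_onI)
    fix i j assume ij: "i \<in> I" "j \<in> I" "c (W i) = c (W j)"
    then have "W i = W j" using inj_onD[OF inj_c] W_\<V> by blast
    then show "i = j" using E_W[OF ij(1,2)] EW by blast
  qed
  then have "card S = card I" by (simp add: S_def card_image)
  moreover have bip: "bipyramid (P C)" if "C \<in> S" for C
    using that bip_P0 W_\<V> by (auto simp: S_def P_c)
  moreover have "S \<subseteq> cells_of_dim K P 3"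
    using bip bipyramid_aff_dim W_\<V> by (auto simp: cells_of_dim_def S_def K_def)
  moreover have "polyhedral_3_sphere (top_of_set (sphere 0 1)) K P h"
    unfolding polyhedral_3_sphere_def using complex homeomorphic_space_refl by blast
  ultimately show ?thesis using card0 by blast
qed

section \<open>Staircase strips in the join of two cycles\<close>

datatype vertex = Xv nat | Yv nat | Rv nat

locale strips =
  fixes n :: nat
  assumes n: "1 \<le> n"
begin

text \<open>
  In the join of two cycles of lengths \<open>n + 2\<close> and \<open>3 n + 2\<close> the tetrahedra correspond to the squares
  of a toroidal grid. The \<open>k\<close>-th strip is the staircase of the squares \<open>(i, 3 k + i)\<close> and
  \<open>(i, 3 k + i + 1)\<close> for \<open>i < n\<close>, together with \<open>(n, 3 k + n)\<close>; \<open>w k\<close> runs through its vertices in stacking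
  order. The lengths make the strips disjoint and leave the diagonals \<open>(i + 1, 3 k + i)\<close> between them.
\<close>

definition X :: "nat \<Rightarrow> vertex" where "X i = Xv (i mod (n + 2))"

definition Y :: "nat \<Rightarrow> vertex" where "Y j = Yv (j mod (3 * n + 2))"

definition square :: "nat \<Rightarrow> nat \<Rightarrow> vertex set"
  where "square i j = {X i, X (i + 1), Y j, Y (j + 1)}"

definition torus :: "vertex set set"
  where "torus = {square i j | i j. True}"

definition w :: "nat \<Rightarrow> nat \<Rightarrow> vertex"
  where "w k m = (if even m then Y (3 * k + m div 2) else X (m div 2))"

primrec stage :: "nat \<Rightarrow> vertex set set" where
  "stage 0 = torus"
| "stage (Suc k) = cone_chain (stage k) (w k) (Rv k) (2 * n + 1)"

section \<open>Arithmetic of the two cycles and of the grid squares\<close>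

lemma X_neq_Y [simp]: "X i \<noteq> Y j" "Y j \<noteq> X i" "X i \<noteq> Rv k" "Rv k \<noteq> X i" "Y i \<noteq> Rv k" "Rv k \<noteq> Y i"
  by (simp_all add: X_def Y_def)

lemma mod_add_cancel_iff: "(a + c) mod q = (b + c) mod q \<longleftrightarrow> a mod q = b mod (q :: nat)"
  unfolding nat_mod_eq_iff by simp

lemma X_add_iff: "X (a + c) = X (b + c) \<longleftrightarrow> X a = X b"
  by (simp add: X_def mod_add_cancel_iff)

lemma Y_add_iff: "Y (a + c) = Y (b + c) \<longleftrightarrow> Y a = Y b"
  by (simp add: Y_def mod_add_cancel_iff)

lemma X_inj: "a < n + 2 \<Longrightarrow> b < n + 2 \<Longrightarrow> X a = X b \<longleftrightarrow> a = b"
  by (simp add: X_def)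

lemma Y_inj: "a < 3 * n + 2 \<Longrightarrow> b < 3 * n + 2 \<Longrightarrow> Y a = Y b \<longleftrightarrow> a = b"
  by (simp add: Y_def)

text \<open>Positivity of \<open>n\<close> enters here: the shorter cycle then has length at least
  3.\<close>

lemma X_near: "X a \<noteq> X (a + 1)" "X a \<noteq> X (a + 2)" "X (a + 1) \<noteq> X a" "X (a + 2) \<noteq> X a"
  using X_add_iff[of 0 a 1] X_add_iff[of 0 a 2] X_inj[of 0 1] X_inj[of 0 2] n
  by (auto simp: add.commute)

lemma Y_near: "Y a \<noteq> Y (a + 1)" "Y a \<noteq> Y (a + 2)" "Y (a + 1) \<noteq> Y a" "Y (a + 2) \<noteq> Y a"
  using Y_add_iff[of 0 a 1] Y_add_iff[of 0 a 2] Y_inj[of 0 1] Y_inj[of 0 2] n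
  by (auto simp: add.commute)

lemma X_mem_square: "X a \<in> square i j \<longleftrightarrow> X a = X i \<or> X a = X (i + 1)"
  by (simp add: square_def)

lemma Y_mem_square: "Y a \<in> square i j \<longleftrightarrow> Y a = Y j \<or> Y a = Y (j + 1)"
  by (simp add: square_def)

lemma square_cong: "X i = X i' \<Longrightarrow> Y j = Y j' \<Longrightarrow> square i j = square i' j'"
  using X_add_iff[of i 1 i'] Y_add_iff[of j 1 j'] by (simp add: square_def)

lemma square_eqD:
  assumes "square i j = square i' j'"
  shows "X i = X i'" "Y j = Y j'"
proof -
  have "X i = X i' \<or> X i = X (i' + 1)" "X (i + 1) = X i' \<or> X (i + 1) = X (i' + 1)"
    "Y j = Y j' \<or> Y j = Y (j' + 1)" "Y (j + 1) = Y j' \<or> Y (j + 1) = Y (j' + 1)"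
    using assms X_mem_square[of _ i j] X_mem_square[of _ i' j'] Y_mem_square[of _ i j] Y_mem_square[of _ i' j']
    by metis+
  \<comment> \<open>Matching the two X-vertices in reverse order would make \<open>X i'\<close>
    equal to \<open>X (i' + 2)\<close>, which happens only in a cycle of length at most 2.\<close>
  moreover have "X i \<noteq> X i' \<Longrightarrow> X i = X (i' + 1) \<Longrightarrow> X (i + 1) = X i' \<Longrightarrow> False"
    using X_add_iff[of i 1 "i' + 1"] X_near(4)[of i'] by (simp add: add.assoc)
  moreover have "Y j \<noteq> Y j' \<Longrightarrow> Y j = Y (j' + 1) \<Longrightarrow> Y (j + 1) = Y j' \<Longrightarrow> False"
    using Y_add_iff[of j 1 "j' + 1"] Y_near(4)[of j'] by (simp add: add.assoc)
  ultimately show "X i = X i'" "Y j = Y j'"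
    using X_add_iff[of i 1 i'] Y_add_iff[of j 1 j'] by metis+
qed

lemma card_square: "card (square i j) = 4"
  using X_near[of i] Y_near[of j] by (simp add: square_def)

text \<open>The four squares around a grid point, which is written with successors so that the
  preceding row and column need no subtraction.\<close>

lemma square_containing:
  assumes t: "t \<in> torus" "X (a + 1) \<in> t" "Y (b + 1) \<in> t"
  shows "t \<in> {square (a + 1) (b + 1), square a (b + 1), square (a + 1) b, square a b}"
proof -
  obtain i j where t': "t = square i j" using t(1) by (auto simp: torus_def)
  have "X i = X (a + 1) \<or> X i = X a"
    using t(2) X_add_iff[of a 1 i] unfolding t' X_mem_square by auto
  moreover have "Y j = Y (b + 1) \<or> Y j = Y b"
    using t(3) Y_add_iff[of b 1 j] unfolding t' Y_mem_square by auto
  ultimately show ?thesis unfolding t' using square_cong by blast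
qed

text \<open>Reducing indices modulo the length treats the closing edge, listed separately in
  \<open>cycle_edges\<close>, like every other edge.\<close>

lemma torus_eq_join: "torus = join (cycle_edges Xv (n + 2)) (cycle_edges Yv (3 * n + 2))"
proof -
  have mod: "cycle_edges f p = {{f (i mod p), f ((i + 1) mod p)} | i. True}" if p: "1 \<le> p" for f :: "nat \<Rightarrow> vertex" and p
  proof (intro equalityI subsetI)
    fix e assume "e \<in> cycle_edges f p"
    then consider "e = {f (p - 1), f 0}" | i where "Suc i < p" "e = {f i, f (Suc i)}"
      by (auto simp: cycle_edges_def)
    then show "e \<in> {{f (i mod p), f ((i + 1) mod p)} | i. True}"
    proof cases
      case 1
      then have "e = {f ((p - 1) mod p), f ((p - 1 + 1) mod p)}" using p by simp
      then show ?thesis by blast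
    next
      case 2
      then have "e = {f (i mod p), f ((i + 1) mod p)}" by simp
      then show ?thesis by blast
    qed
  next
    fix e assume "e \<in> {{f (i mod p), f ((i + 1) mod p)} | i. True}"
    then obtain i where e: "e = {f (i mod p), f ((i + 1) mod p)}" by blast
    define j where "j = i mod p"
    have j: "j < p" "(i + 1) mod p = (if Suc j = p then 0 else Suc j)"
      using p by (simp_all add: j_def mod_Suc)
    show "e \<in> cycle_edges f p"
    proof (cases "Suc j = p")
      case True
      then have "j = p - 1" by simp
      then show ?thesis using e j True unfolding j_def[symmetric] by (simp add: cycle_edges_def)
    next
      case False
      then show ?thesis using e j unfolding j_def[symmetric] by (auto simp: cycle_edges_def)
    qed
  qed
  have XY: "cycle_edges Xv (n + 2) = {{X i, X (i + 1)} | i. True}"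
    "cycle_edges Yv (3 * n + 2) = {{Y i, Y (i + 1)} | i. True}"
    using mod[of "n + 2" Xv] mod[of "3 * n + 2" Yv] by (simp_all add: X_def Y_def)
  have sq: "square i j = {X i, X (i + 1)} \<union> {Y j, Y (j + 1)}" for i j
    by (auto simp: square_def)
  show ?thesis unfolding torus_def join_def XY sq by blast
qed

lemma torus_homeomorphic_sphere: "realization torus homeomorphic sphere (0 :: real^4) 1"
  unfolding torus_eq_join using n
  by (intro join_cycles_homeomorphic_sphere) (auto simp: inj_def)

section \<open>The strips as stacked chains of squares\<close>

lemma w_even: "w k (2 * a) = Y (3 * k + a)"
  by (simp add: w_def)

lemma w_odd: "w k (2 * a + 1) = X a"
  by (simp add: w_def)

lemma Rv_notin_w: "Rv j \<notin> w k ` I"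
  by (auto simp: w_def X_def Y_def)

text \<open>A chain of 2 n + 1 tetrahedra has indices up to 2 n + 3. Halving them gives at most n +
  1, below both cycle lengths, so a strip does not close up on itself.\<close>

lemma inj_w: "inj_on (w k) {..2 * n + 3}"
proof (rule inj_onI)
  fix m m' assume m: "m \<in> {..2 * n + 3}" "m' \<in> {..2 * n + 3}" "w k m = w k m'"
  have le: "m div 2 < n + 2" "m' div 2 < n + 2" using m by auto
  have eq: "even m = even m'" using m(3) by (auto simp: w_def split: if_splits)
  have "m div 2 = m' div 2"
  proof (cases "even m")
    case True
    then have "Y (m div 2 + 3 * k) = Y (m' div 2 + 3 * k)" using m(3) eq by (simp add: w_def add.commute)
    then show ?thesis using le Y_add_iff Y_inj by simp
  next
    case False
    then show ?thesis using m(3) eq le X_inj by (simp add: w_def)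
  qed
  then show "m = m'" using eq by (metis bit_eq_rec)
qed

text \<open>Passing from even to odd \<open>l\<close> moves the square by one column, from odd to
  even by one row, which produces the staircase.\<close>

lemma chain_square: "w k ` {l..l + 3} = square (l div 2) (3 * k + (l + 1) div 2)"
proof -
  have s: "{l..l + 3} = {l, l + 1, l + 2, l + 3}" by auto
  show ?thesis
  proof (cases "even l")
    case True
    then obtain a where l: "l = 2 * a" by blast
    have e: "l = 2 * a" "l + 1 = 2 * a + 1" "l + 2 = 2 * (a + 1)" "l + 3 = 2 * (a + 1) + 1"
      using l by simp_all
    have "w k l = Y (3 * k + a)" "w k (l + 1) = X a" "w k (l + 2) = Y (3 * k + a + 1)" "w k (l + 3) = X (a + 1)"
 unfolding e(2-4) w_even w_odd
      by (simp_all only: e(1) w_even add.assoc)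
    moreover have "l div 2 = a" "(l + 1) div 2 = a" using l by simp_all
    ultimately show ?thesis unfolding s by (simp only: image_insert image_empty square_def) blast
  next
    case False
    then obtain a where l: "l = 2 * a + 1" using oddE by blast
    have e: "l = 2 * a + 1" "l + 1 = 2 * (a + 1)" "l + 2 = 2 * (a + 1) + 1" "l + 3 = 2 * (a + 2)"
      using l by simp_all
    have "w k l = X a" "w k (l + 1) = Y (3 * k + (a + 1))" "w k (l + 2) = X (a + 1)" "w k (l + 3) = Y (3 * k + (a + 1) + 1)"
      unfolding e(2-4) w_even w_odd by (simp_all only: e(1) w_odd) (simp_all add: add.assoc)
    moreover have "l div 2 = a" "(l + 1) div 2 = a + 1" using l by simp_all
    ultimately show ?thesis unfolding s by (simp only: image_insert image_empty square_def) blast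
  qed
qed

lemma chain_even: "w k ` {2 * a..2 * a + 3} = square a (3 * k + a)"
  using chain_square[of k "2 * a"] by simp

lemma chain_odd: "w k ` {2 * a + 1..2 * a + 1 + 3} = square a (3 * k + a + 1)"
  using chain_square[of k "2 * a + 1"] by simp

definition chain :: "nat \<Rightarrow> vertex set set"
  where "chain k = {w k ` {l..l + 3} | l. l < 2 * n + 1}"

lemma square_in_chain:
  assumes "square i j \<in> chain k" "i \<le> n" "k < n"
  shows "Y j = Y (3 * k + i) \<or> Y j = Y (3 * k + i + 1)"
proof -
  obtain l where l: "l < 2 * n + 1" "square i j = square (l div 2) (3 * k + (l + 1) div 2)"
    using assms(1) chain_square by (auto simp: chain_def)
  have "i = l div 2" using square_eqD(1)[OF l(2)] X_inj[of i "l div 2"] l(1) assms(2) by simp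
  moreover have "(l + 1) div 2 = l div 2 \<or> (l + 1) div 2 = l div 2 + 1" by auto
  ultimately show ?thesis using square_eqD(2)[OF l(2)] by auto
qed

lemma chain_row:
  assumes "t \<in> chain k"
  obtains i where "i \<le> n" "t = square i (3 * k + i) \<or> t = square i (3 * k + i + 1)"
proof -
  obtain l where l: "l < 2 * n + 1" "t = square (l div 2) (3 * k + (l + 1) div 2)"
    using assms chain_square by (auto simp: chain_def)
  moreover have "(l + 1) div 2 = l div 2 \<or> (l + 1) div 2 = l div 2 + 1" by auto
  ultimately show ?thesis using that[of "l div 2"] by (auto simp: add.assoc)
qed

text \<open>As 3 k + \<epsilon> is at most 3 n - 1, the blocks of three columns do not overlap
  modulo 3 n + 2. In each row offsets 0 and 1 belong to the strip, and offset 2 separates it from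
  the next.\<close>

lemma Y_block:
  assumes "k < n" "k' < n" "\<epsilon> \<le> 2" "\<epsilon>' \<le> 2" "Y (3 * k + i + \<epsilon>) = Y (3 * k' + i + \<epsilon>')"
  shows "k = k' \<and> \<epsilon> = \<epsilon>'"
proof -
  have "Y (3 * k + \<epsilon> + i) = Y (3 * k' + \<epsilon>' + i)" using assms(5) by (simp add: ac_simps)
  then have "Y (3 * k + \<epsilon>) = Y (3 * k' + \<epsilon>')" by (simp only: Y_add_iff)
  then have "3 * k + \<epsilon> = 3 * k' + \<epsilon>'" using assms(1-4) by (subst (asm) Y_inj) auto
  then show ?thesis using assms(3,4) by presburger
qed

lemma chain_disjoint:
  assumes "k < n" "k' < n" "t \<in> chain k" "t \<in> chain k'"
  shows "k = k'"
proof -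
  obtain i where i: "i \<le> n" "t = square i (3 * k + i) \<or> t = square i (3 * k + i + 1)"
    using chain_row[OF assms(3)] .
  show ?thesis
    using i square_in_chain[of i _ k'] assms(2,4)
      Y_block[OF assms(1,2), of 0 0 i] Y_block[OF assms(1,2), of 0 1 i]
      Y_block[OF assms(1,2), of 1 0 i] Y_block[OF assms(1,2), of 1 1 i] by auto
qed

lemma chain_subset_torus: "chain k \<subseteq> torus"
  using chain_square by (auto simp: chain_def torus_def)

text \<open>Three consecutive vertices contain an edge of one cycle, which fixes the square in that
  direction, and a single vertex of the other cycle, which leaves two choices.\<close>

lemma inner_triangle:
  assumes t: "t \<in> torus" "w k ` {m..m + 2} \<subseteq> t" and m: "1 \<le> m"
  shows "t = w k ` {m - 1..m + 2} \<or> t = w k ` {m..m + 3}"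
proof (cases "even m")
  case True
  then obtain a where a: "m = 2 * (a + 1)"
    using m by (metis One_nat_def Suc_eq_plus1 evenE mult_0_right not0_implies_Suc not_one_le_zero)
  have "w k m \<in> t" "w k (m + 1) \<in> t" "w k (m + 2) \<in> t" using t(2) by auto
  then have v: "Y (3 * k + a + 1) \<in> t" "X (a + 1) \<in> t" "Y (3 * k + a + 2) \<in> t"
    using w_even[of k "a + 1"] w_odd[of k "a + 1"] w_even[of k "a + 2"] unfolding a by (simp_all add: add.assoc)
  have "Y (3 * k + a + 2) \<notin> square i (3 * k + a)" for i
    using Y_near[of "3 * k + a"] Y_near[of "3 * k + a + 1"] by (simp add: Y_mem_square add.assoc)
  then have "t = square (a + 1) (3 * k + a + 1) \<or> t = square a (3 * k + a + 1)"
    using square_containing[OF t(1) v(2,1)] v(3) by auto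
  moreover have "w k ` {m..m + 3} = square (a + 1) (3 * k + a + 1)"
    using chain_even[of k "a + 1"] unfolding a by (simp only: add.assoc)
  moreover have "w k ` {m - 1..m + 2} = square a (3 * k + a + 1)"
  proof -
    have "m - 1 = 2 * a + 1" "m + 2 = 2 * a + 1 + 3" using a by simp_all
    then show ?thesis using chain_odd[of k a] by (simp only:)
  qed
  ultimately show ?thesis by blast
next
  case False
  then obtain a where a: "m = 2 * a + 1" using oddE by blast
  have "w k m \<in> t" "w k (m + 1) \<in> t" "w k (m + 2) \<in> t" using t(2) by auto
  then have v: "X a \<in> t" "Y (3 * k + a + 1) \<in> t" "X (a + 1) \<in> t"
    using w_odd[of k a] w_even[of k "a + 1"] w_odd[of k "a + 1"] unfolding a by (simp_all add: add.assoc)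
  have "X a \<notin> square (a + 1) j" for j
    using X_near[of a] by (simp add: X_mem_square add.assoc)
  then have "t = square a (3 * k + a + 1) \<or> t = square a (3 * k + a)"
    using square_containing[OF t(1) v(3,2)] v(1) by auto
  moreover have "w k ` {m..m + 3} = square a (3 * k + a + 1)"
    using chain_odd[of k a] unfolding a .
  moreover have "w k ` {m - 1..m + 2} = square a (3 * k + a)"
  proof -
    have "m - 1 = 2 * a" "m + 2 = 2 * a + 3" using a by simp_all
    then show ?thesis using chain_even[of k a] by (simp only:)
  qed
  ultimately show ?thesis by blast
qed

section \<open>Coning off the strips one after another\<close>

lemma stage_iff:
  "t \<in> stage j \<longleftrightarrow> (t \<in> torus \<and> (\<forall>k<j. t \<notin> chain k)) \<or>
    (\<exists>k<j. \<exists>I\<in>chain_boundary (2 * n + 1). t = insert (Rv k) (w k ` I))"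
proof (induction j)
  case (Suc j)
  define B where "B k \<longleftrightarrow> (\<exists>I\<in>chain_boundary (2 * n + 1). t = insert (Rv k) (w k ` I))" for k
  \<comment> \<open>Coning off a strip never deletes an earlier cone tetrahedron, since the latter
    contains an \<open>Rv\<close> vertex and strips contain none.\<close>
  have B: "t \<notin> chain j" if "B k" for k
  proof
    assume "t \<in> chain j"
    then obtain l where "t = w j ` {l..l + 3}" by (auto simp: chain_def)
    then have "Rv k \<in> w j ` {l..l + 3}" using that by (auto simp: B_def)
    then show False using Rv_notin_w by blast
  qed
  have "stage (Suc j) = stage j - chain j \<union> (\<lambda>I. insert (Rv j) (w j ` I)) ` chain_boundary (2 * n + 1)"
    by (simp only: stage.simps cone_chain_def chain_def)
  then have "t \<in> stage (Suc j) \<longleftrightarrow> t \<in> stage j \<and> t \<notin> chain j \<or> B j"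
    by (simp add: B_def image_iff)
  also have "\<dots> \<longleftrightarrow> (t \<in> torus \<and> (\<forall>k<Suc j. t \<notin> chain k)) \<or> (\<exists>k<Suc j. B k)"
    unfolding Suc.IH less_Suc_eq B_def[symmetric] using B by blast
  finally show ?case unfolding B_def .
qed simp

lemma cone_subset_chain:
  assumes "I \<in> chain_boundary (2 * n + 1)"
  obtains t where "t \<in> chain k" "w k ` I \<subseteq> t"
proof -
  obtain l where l: "l < 2 * n + 1" "I \<subseteq> {l..l + 3}" using chain_boundary_subset[OF assms] by auto
  have "w k ` {l..l + 3} \<in> chain k" using l(1) by (auto simp: chain_def)
  then show ?thesis by (rule that[OF _ image_mono[OF l(2)]])
qed

lemma card_stage: "t \<in> stage j \<Longrightarrow> card t = 4"
proof -
  assume "t \<in> stage j"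
  then consider "t \<in> torus" | k I where "I \<in> chain_boundary (2 * n + 1)" "t = insert (Rv k) (w k ` I)"
    unfolding stage_iff by blast
  then show ?thesis
  proof cases
    case 1 then show ?thesis using card_square by (auto simp: torus_def)
  next
    case 2
    have "inj_on (w k) I"
      using inj_on_subset[OF inj_w] chain_boundary_bounded[OF 2(1)] by (simp add: eval_nat_numeral)
    then have "card (w k ` I) = 3"
      using chain_boundary_card[OF 2(1)] by (simp add: card_image)
    moreover from this have "finite (w k ` I)" by (intro card_ge_0_finite) simp
    ultimately show ?thesis using 2(2) Rv_notin_w by simp
  qed
qed

text \<open>The delicate point is that inner triangles of the next strip must not lie in earlier
  cones. A cone facet meets the grid in a triangle of a tetrahedron of its own strip; by
  \<open>inner_triangle\<close> that tetrahedron would belong to the next strip too, but strips are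
  disjoint.\<close>

lemma stage_homeomorphic_sphere: "j \<le> n \<Longrightarrow> realization (stage j) homeomorphic sphere (0 :: real^4) 1"
proof (induction j)
  case 0
  then show ?case using torus_homeomorphic_sphere by simp
next
  case (Suc j)
  have "realization (stage j) homeomorphic realization (stage (Suc j))"
    unfolding stage.simps
  proof (rule cone_chain_homeomorphic[OF card_stage])
    show "inj_on (w j) {..2 * n + 1 + 2}" using inj_w by (simp add: eval_nat_numeral)
    show "w j ` {l..l + 3} \<in> stage j" if l: "l < 2 * n + 1" for l
    proof -
      have c: "w j ` {l..l + 3} \<in> chain j" using l by (auto simp: chain_def)
      then have "w j ` {l..l + 3} \<notin> chain k" if "k < j" for k
        using chain_disjoint[of k j] that Suc.prems by auto
      then show ?thesis using c chain_subset_torus unfolding stage_iff by blast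
    qed
    show "Rv j \<notin> \<Union>(stage j)"
    proof
      assume "Rv j \<in> \<Union>(stage j)"
      then obtain t where t: "t \<in> stage j" "Rv j \<in> t" by blast
      have "Rv j \<notin> t" if "t \<in> torus" using that by (auto simp: torus_def square_def)
      then show False using t Rv_notin_w unfolding stage_iff by auto
    qed
    show "t = w j ` {m - 1..m + 2} \<or> t = w j ` {m..m + 3}"
      if t: "t \<in> stage j" "1 \<le> m" "m < 2 * n + 1" "w j ` {m..m + 2} \<subseteq> t" for t m
    proof (cases "t \<in> torus")
      case True
      then show ?thesis using inner_triangle t by blast
    next
      case False
      then obtain k I where k: "k < j" "I \<in> chain_boundary (2 * n + 1)" "t = insert (Rv k) (w k ` I)"
        using t(1) unfolding stage_iff by blast
      obtain t' where t': "t' \<in> chain k" "w k ` I \<subseteq> t'" using cone_subset_chain[OF k(2)] .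
      have "w j ` {m..m + 2} \<subseteq> w k ` I"
        using t(4) unfolding k(3) subset_insert[OF Rv_notin_w] .
      then have sub: "w j ` {m..m + 2} \<subseteq> t'" using t'(2) by (rule subset_trans)
      have "t' \<in> torus" using t'(1) chain_subset_torus by blast
      from inner_triangle[OF this sub t(2)] have "t' \<in> chain j"
      proof
        assume "t' = w j ` {m - 1..m + 2}"
        moreover have "m + 2 = m - 1 + 3" using t(2) by simp
        ultimately have "t' = w j ` {m - 1..m - 1 + 3}" by (simp only:)
        then show ?thesis using t(3) unfolding chain_def by (intro CollectI exI[of _ "m - 1"]) simp
      qed (use t(3) in \<open>auto simp: chain_def\<close>)
      then show ?thesis using chain_disjoint[of k j t'] t'(1) k(1) Suc.prems by simp
    qed
  qed simp_all
  then show ?case using Suc by (meson Suc_leD homeomorphic_sym homeomorphic_trans)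
qed

end

section \<open>The edges of degree three\<close>

text \<open>The range of \<open>c\<close> excludes the two end triangles; the side triangles
  starting at \<open>c\<close> and at \<open>c - 2\<close> are the only others containing both
  indices.\<close>

lemma chain_boundary_consecutive:
  assumes "I \<in> chain_boundary N" "c \<in> I" "c + 1 \<in> I" "2 \<le> c" "c < N"
  shows "I = {c, c + 1, c + 3} \<or> I = {c - 2, c, c + 1}"
proof -
  consider "I = {0..2}" | "I = {N..N + 2}" | l where "I = {l, l + 1, l + 3}" | l where "I = {l, l + 2, l + 3}"
    using assms(1) by (auto simp: chain_boundary_def)
  then show ?thesis
  proof cases
    case 3 then show ?thesis using assms(2,3) by auto
  next
    case 4 then show ?thesis using assms(2,3) by auto
  qed (use assms in auto)
qed

context strips
begin

abbreviation T where "T \<equiv> stage n"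

text \<open>
  Three of the four squares around the grid point \<open>(i + 1, 3 k + i + 1)\<close> lie in the strip \<open>k\<close>, the
  fourth one is a kept square. Hence, after coning off the strips, the edge joining \<open>X (i + 1)\<close> and
  \<open>Y (3 k + i + 1)\<close> has degree three.
\<close>

definition apex1 where "apex1 = (\<lambda>(i, k). X (i + 1))"
definition apex2 where "apex2 = (\<lambda>(i, k). Y (3 * k + i + 1))"
definition base1 where "base1 = (\<lambda>(i :: nat, k :: nat). X (i + 2))"
definition base2 where "base2 = (\<lambda>(i, k). Y (3 * k + i))"
definition base3 where "base3 = (\<lambda>(i :: nat, k). Rv k)"

lemmas bipyramid_vertices = apex1_def apex2_def base1_def base2_def base3_def

text \<open>The axis has the consecutive strip indices 2 i + 2 and 2 i + 3. The base vertices on the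
  strip have indices 2 i and 2 i + 5, the third indices of the two boundary triangles at that
  edge.\<close>

lemma w_vertices:
  "w k (2 * i) = Y (3 * k + i)" "w k (2 * i + 2) = Y (3 * k + i + 1)"
  "w k (2 * i + 3) = X (i + 1)" "w k (2 * i + 5) = X (i + 2)"
  using w_even[of k i] w_even[of k "i + 1"] w_odd[of k "i + 1"] w_odd[of k "i + 2"]
  by (simp_all add: eval_nat_numeral)

lemma w_mem:
  assumes "I \<in> chain_boundary (2 * n + 1)" "m \<le> 2 * n + 3"
  shows "w k m \<in> w k ` I \<longleftrightarrow> m \<in> I"
proof -
  have "I \<subseteq> {..2 * n + 3}" using chain_boundary_bounded[OF assms(1)] by (simp add: eval_nat_numeral)
  then show ?thesis using inj_on_image_mem_iff[OF inj_w] assms(2) by simp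
qed

text \<open>In row i + 1 a strip occupies the columns 3 k' + i + 1 and 3 k' + i + 2, whose offsets 1
  and 2 differ from the offset 0 of the kept square.\<close>

lemma kept_square_notin_chain:
  assumes "i < n" "k < n" "k' < n"
  shows "square (i + 1) (3 * k + i) \<notin> chain k'"
proof
  assume "square (i + 1) (3 * k + i) \<in> chain k'"
  then have "Y (3 * k + i + 0) = Y (3 * k' + i + 1) \<or> Y (3 * k + i + 0) = Y (3 * k' + i + 2)"
    using square_in_chain[of "i + 1" "3 * k + i" k'] assms by (simp add: add.assoc)
  then show False using Y_block[OF assms(2,3), of 0 1 i] Y_block[OF assms(2,3), of 0 2 i] by auto
qed

lemma chain_squares_around:
  assumes "i < n"
  shows "square (i + 1) (3 * k + i + 1) \<in> chain k" "square i (3 * k + i + 1) \<in> chain k"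
    "square i (3 * k + i) \<in> chain k"
proof -
  have c: "w k ` {l..l + 3} \<in> chain k" if "l < 2 * n + 1" for l
    using that by (auto simp: chain_def)
  show "square (i + 1) (3 * k + i + 1) \<in> chain k"
    using c[of "2 * (i + 1)"] chain_even[of k "i + 1"] assms by (simp add: add.assoc)
  show "square i (3 * k + i + 1) \<in> chain k"
    using c[of "2 * i + 1"] chain_odd[of k i] assms by simp
  show "square i (3 * k + i) \<in> chain k"
    using c[of "2 * i"] chain_even[of k i] assms by simp
qed

text \<open>Of the four squares around the grid point only the kept one is still a facet. A cone
  facet at the same edge has its grid triangle inside one of the other three squares, so its apex is
  \<open>Rv k\<close>; and on the boundary of the strip the edge lies in just two triangles.\<close>

lemma star_cases:
  assumes i: "i < n" "k < n" and t: "t \<in> T" "X (i + 1) \<in> t" "Y (3 * k + i + 1) \<in> t"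
  shows "t \<subseteq> {X (i + 1), Y (3 * k + i + 1), X (i + 2), Y (3 * k + i), Rv k}"
proof (cases "t \<in> torus \<and> (\<forall>k<n. t \<notin> chain k)")
  case True
  then have "t = square (i + 1) (3 * k + i)"
    using square_containing[of t i "3 * k + i"] t(2,3) chain_squares_around[OF i(1), of k] i(2) by auto
  then show ?thesis by (auto simp: square_def)
next
  case False
  then obtain k' I where k': "k' < n" "I \<in> chain_boundary (2 * n + 1)" "t = insert (Rv k') (w k' ` I)"
    using t(1) unfolding stage_iff by blast
  obtain t' where t': "t' \<in> chain k'" "w k' ` I \<subseteq> t'" using cone_subset_chain[OF k'(2)] .
  have xy: "X (i + 1) \<in> w k' ` I" "Y (3 * k + i + 1) \<in> w k' ` I" using t(2,3) unfolding k'(3) by simp_all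
  have "t' \<in> torus" "X (i + 1) \<in> t'" "Y (3 * k + i + 1) \<in> t'" using chain_subset_torus t' xy by blast+
  from square_containing[OF this] have "t' \<in> chain k"
    using chain_squares_around[OF i(1), of k] kept_square_notin_chain[OF i k'(1)] t'(1) by auto
  then have k: "k' = k" using chain_disjoint[OF k'(1) i(2) t'(1)] by simp
  have "2 * i + 2 \<in> I" "2 * i + 3 \<in> I"
    using xy w_mem[OF k'(2), of "2 * i + 2" k] w_mem[OF k'(2), of "2 * i + 3" k] i(1)
    unfolding k w_vertices by simp_all
  then have "I = {2 * i + 2, 2 * i + 2 + 1, 2 * i + 2 + 3} \<or> I = {2 * i + 2 - 2, 2 * i + 2, 2 * i + 2 + 1}"
    using chain_boundary_consecutive[OF k'(2), of "2 * i + 2"] i(1) by (simp add: eval_nat_numeral)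
  then have "I = {2 * i + 2, 2 * i + 3, 2 * i + 5} \<or> I = {2 * i, 2 * i + 2, 2 * i + 3}"
    by (simp add: eval_nat_numeral)
  then show ?thesis
  proof
    assume I: "I = {2 * i + 2, 2 * i + 3, 2 * i + 5}"
    show ?thesis unfolding k'(3) k I image_insert image_empty w_vertices by blast
  next
    assume I: "I = {2 * i, 2 * i + 2, 2 * i + 3}"
    show ?thesis unfolding k'(3) k I image_insert image_empty w_vertices by blast
  qed
qed

lemma cone_facet:
  assumes "k < n" "I \<in> chain_boundary (2 * n + 1)"
  shows "insert (Rv k) (w k ` I) \<in> T"
  unfolding stage_iff by (intro disjI2) (use assms in blast)

lemma star_tetrahedra:
  assumes i: "i < n" "k < n"
  shows "{X (i + 1), Y (3 * k + i + 1), X (i + 2), Y (3 * k + i)} \<in> T"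
    "{X (i + 1), Y (3 * k + i + 1), Y (3 * k + i), Rv k} \<in> T"
    "{X (i + 1), Y (3 * k + i + 1), X (i + 2), Rv k} \<in> T"
proof -
  have "square (i + 1) (3 * k + i) \<in> T"
    using kept_square_notin_chain[OF i] unfolding stage_iff torus_def by blast
  moreover have "square (i + 1) (3 * k + i) = {X (i + 1), Y (3 * k + i + 1), X (i + 2), Y (3 * k + i)}"
    by (auto simp: square_def)
  ultimately show "{X (i + 1), Y (3 * k + i + 1), X (i + 2), Y (3 * k + i)} \<in> T" by simp
  have "{2 * i, 2 * i + 2, 2 * i + 3} \<in> chain_boundary (2 * n + 1)"
    using i(1) unfolding chain_boundary_def by (intro UnI2 CollectI exI[of _ "2 * i"]) simp
  from cone_facet[OF i(2) this]
  show "{X (i + 1), Y (3 * k + i + 1), Y (3 * k + i), Rv k} \<in> T"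
    unfolding image_insert image_empty w_vertices by (simp only: insert_commute)
  have "{2 * i + 2, 2 * i + 3, 2 * i + 5} \<in> chain_boundary (2 * n + 1)"
    using i(1) unfolding chain_boundary_def
    by (intro UnI1[OF UnI2] CollectI exI[of _ "2 * i + 2"]) (simp add: eval_nat_numeral)
  from cone_facet[OF i(2) this]
  show "{X (i + 1), Y (3 * k + i + 1), X (i + 2), Rv k} \<in> T"
    unfolding image_insert image_empty w_vertices by (simp only: insert_commute)
qed

text \<open>The vertex \<open>Rv k\<close> occurs only in the cone over strip \<open>k\<close>. The
  other two base vertices have strip indices at distance 5, whereas the indices of a boundary
  triangle lie within distance 3.\<close>

lemma base_triangle_not_face:
  assumes i: "i < n" "k < n" and t: "t \<in> T"
  shows "\<not> {X (i + 2), Y (3 * k + i), Rv k} \<subseteq> t"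
proof
  assume sub: "{X (i + 2), Y (3 * k + i), Rv k} \<subseteq> t"
  have "Rv k \<notin> square a b" for a b by (simp add: square_def)
  then have "t \<notin> torus" using sub by (auto simp: torus_def)
  then obtain k' I where k': "I \<in> chain_boundary (2 * n + 1)" "t = insert (Rv k') (w k' ` I)"
    using t unfolding stage_iff by blast
  have "k' = k" using sub Rv_notin_w[of k k' I] unfolding k'(2) by auto
  have "w k (2 * i + 5) \<in> w k ` I" "w k (2 * i) \<in> w k ` I"
    using sub unfolding k'(2) \<open>k' = k\<close> w_vertices by simp_all
  then have "2 * i + 5 \<in> I" "2 * i \<in> I"
    using w_mem[OF k'(1), of "2 * i + 5" k] w_mem[OF k'(1), of "2 * i" k] i(1) by simp_all
  moreover obtain l where "I \<subseteq> {l..l + 3}" using chain_boundary_subset[OF k'(1)] by auto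
  ultimately have "2 * i + 5 \<in> {l..l + 3}" "2 * i \<in> {l..l + 3}" by blast+
  then show False by simp
qed

text \<open>Coning off loses no vertex: every vertex of a strip lies on a boundary triangle and so
  on a cone tetrahedron.\<close>

lemma vertex_set: "\<Union>T = Xv ` {..<n + 2} \<union> Yv ` {..<3 * n + 2} \<union> Rv ` {..<n}"
proof (intro equalityI subsetI)
  fix v assume "v \<in> \<Union>T"
  then obtain t where t: "t \<in> T" "v \<in> t" by blast
  have X: "X a \<in> Xv ` {..<n + 2}" and Y: "Y a \<in> Yv ` {..<3 * n + 2}" for a
    by (simp_all add: X_def Y_def)
  from t(1) consider "t \<in> torus" | k I where "k < n" "t = insert (Rv k) (w k ` I)"
    unfolding stage_iff by blast
  then show "v \<in> Xv ` {..<n + 2} \<union> Yv ` {..<3 * n + 2} \<union> Rv ` {..<n}"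
  proof cases
    case 1
    then obtain i j where "t = square i j" by (auto simp: torus_def)
    then show ?thesis using t(2) X Y by (auto simp: square_def)
  next
    case 2
    have "w k m \<in> Xv ` {..<n + 2} \<union> Yv ` {..<3 * n + 2}" for m
      using X Y by (simp add: w_def)
    then show ?thesis using t(2) 2 by auto
  qed
next
  have torus: "v \<in> \<Union>T" if v: "t \<in> torus" "v \<in> t" for v t
  proof (cases "\<forall>k<n. t \<notin> chain k")
    case True
    then have "t \<in> T" using v(1) by (simp add: stage_iff)
    then show ?thesis using v(2) by (rule UnionI)
  next
    case False
    then obtain k l where k: "k < n" "l < 2 * n + 1" "t = w k ` {l..l + 3}"
      by (auto simp: chain_def)
    then obtain m where m: "m \<in> {l..l + 3}" "v = w k m" using v(2) by blast
    have "\<exists>I\<in>chain_boundary (2 * n + 1). m \<in> I"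
    proof (cases "m < 2 * n + 1")
      case True
      then have "{m, m + 1, m + 3} \<in> chain_boundary (2 * n + 1)" by (auto simp: chain_boundary_def)
      then show ?thesis by blast
    next
      case False
      then have "m \<in> {2 * n + 1..2 * n + 1 + 2}" using m(1) k(2) by simp
      moreover have "{2 * n + 1..2 * n + 1 + 2} \<in> chain_boundary (2 * n + 1)" by (simp add: chain_boundary_def)
      ultimately show ?thesis by blast
    qed
    then obtain I where "I \<in> chain_boundary (2 * n + 1)" "m \<in> I" by blast
    then have "v \<in> insert (Rv k) (w k ` I)" "insert (Rv k) (w k ` I) \<in> T"
      using m(2) cone_facet[OF k(1)] by simp_all
    then show ?thesis by (rule UnionI[rotated])
  qed
  fix v assume "v \<in> Xv ` {..<n + 2} \<union> Yv ` {..<3 * n + 2} \<union> Rv ` {..<n}"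
  then consider i where "i < n + 2" "v = Xv i" | j where "j < 3 * n + 2" "v = Yv j" | k where "k < n" "v = Rv k"
    by blast
  then show "v \<in> \<Union>T"
  proof cases
    case 1
    then have "v \<in> square i 0" by (simp add: square_def X_def)
    moreover have "square i 0 \<in> torus" unfolding torus_def by blast
    ultimately show ?thesis using torus by blast
  next
    case 2
    then have "v \<in> square 0 j" by (simp add: square_def Y_def)
    moreover have "square 0 j \<in> torus" unfolding torus_def by blast
    ultimately show ?thesis using torus by blast
  next
    case 3
    have "{0..2} \<in> chain_boundary (2 * n + 1)" by (simp add: chain_boundary_def)
    from UnionI[OF cone_facet[OF 3(1) this] insertI1] show ?thesis using 3(2) by simp
  qed
qed

lemma card_vertex_set: "card (\<Union>T) = 5 * n + 4"
proof -
  have "card (\<Union>T) = card (Xv ` {..<n + 2}) + card (Yv ` {..<3 * n + 2}) + card (Rv ` {..<n})"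
    unfolding vertex_set by (subst card_Un_disjoint; (subst card_Un_disjoint)?) auto
  then show ?thesis by (simp add: card_image inj_on_def)
qed

lemma finite_T: "finite T"
proof -
  have "finite (\<Union>T)" unfolding vertex_set by simp
  then show ?thesis by (rule finite_UnionD)
qed

text \<open>By \<open>star_cases\<close> the X-apex of the second edge is an X-vertex of the first
  star, so i' is i or i + 1. In the latter case the Y-apices would identify offset 2 of a block with
  offset 0 or 1, which \<open>Y_block\<close> excludes.\<close>

lemma star_disjoint:
  assumes i: "i < n" "k < n" "i' < n" "k' < n" and t: "t \<in> T"
    "X (i + 1) \<in> t" "Y (3 * k + i + 1) \<in> t" "X (i' + 1) \<in> t" "Y (3 * k' + i' + 1) \<in> t"
  shows "i = i' \<and> k = k'"
proof -
  have "X (i' + 1) \<in> {X (i + 1), Y (3 * k + i + 1), X (i + 2), Y (3 * k + i), Rv k}"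
    "Y (3 * k' + i' + 1) \<in> {X (i + 1), Y (3 * k + i + 1), X (i + 2), Y (3 * k + i), Rv k}"
    by (rule subsetD[OF star_cases[OF i(1,2) t(1-3)] t(4)]) (rule subsetD[OF star_cases[OF i(1,2) t(1-3)] t(5)])
  then have x: "X (i' + 1) = X (i + 1) \<or> X (i' + 1) = X (i + 2)"
    and y: "Y (3 * k' + i' + 1) = Y (3 * k + i + 1) \<or> Y (3 * k' + i' + 1) = Y (3 * k + i)"
    by auto
  from x have "i' = i \<or> i' = i + 1"
    using X_inj[of "i' + 1" "i + 1"] X_inj[of "i' + 1" "i + 2"] i(1,3) by auto
  then show ?thesis
  proof
    assume "i' = i"
    then show ?thesis
      using y Y_block[OF i(4,2), of 1 1 i] Y_block[OF i(4,2), of 1 0 i] by auto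
  next
    assume "i' = i + 1"
    then have "Y (3 * k' + i + 2) = Y (3 * k + i + 1) \<or> Y (3 * k' + i + 2) = Y (3 * k + i + 0)"
      using y by (simp add: add.assoc)
    then show ?thesis
      using Y_block[OF i(4,2), of 2 1 i] Y_block[OF i(4,2), of 2 0 i] by auto
  qed
qed

lemma polyhedral_sphere_with_bipyramids:
  "\<exists>(X :: (real^4) topology) K P h. polyhedral_3_sphere X K P h \<and>
    card (cells_of_dim K P 0) = 5 * n + 4 \<and>
    (\<exists>S \<subseteq> cells_of_dim K P 3. card S = n^2 \<and> (\<forall>C\<in>S. bipyramid (P C)))"
proof -
  define I where "I = {..<n} \<times> {..<n}"
  have "\<exists>(X :: (real^4) topology) K P h. polyhedral_3_sphere X K P h \<and>
    card (cells_of_dim K P 0) = card (\<Union>T) \<and>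
    (\<exists>S \<subseteq> cells_of_dim K P 3. card S = card I \<and> (\<forall>C\<in>S. bipyramid (P C)))"
  proof (rule polyhedral_sphere_of_triangulation[where x = apex1 and y = apex2
        and p = base1 and q = base2 and r = base3])
    show "finite T" by (rule finite_T)
    show "card t = 4" if "t \<in> T" for t by (rule card_stage[OF that])
    show "realization T homeomorphic sphere (0 :: real^4) 1" by (rule stage_homeomorphic_sphere) simp
    show "finite I" by (simp add: I_def)
  next
    fix a assume "a \<in> I"
    then obtain i k where a: "a = (i, k)" "i < n" "k < n" by (auto simp: I_def)
    show "distinct [apex1 a, apex2 a, base1 a, base2 a, base3 a]"
      using X_near(1)[of "i + 1"] Y_near(3)[of "3 * k + i"] by (simp add: a bipyramid_vertices)
    show "{apex1 a, apex2 a, base1 a, base2 a} \<in> T \<and> {apex1 a, apex2 a, base2 a, base3 a} \<in> T \<and>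
        {apex1 a, apex2 a, base1 a, base3 a} \<in> T"
      using star_tetrahedra[OF a(2,3)] by (simp add: a(1) bipyramid_vertices)
    fix t assume t: "t \<in> T"
    show "\<not> {base1 a, base2 a, base3 a} \<subseteq> t"
      using base_triangle_not_face[OF a(2,3) t] by (simp add: a(1) bipyramid_vertices)
    show "t \<subseteq> {apex1 a, apex2 a, base1 a, base2 a, base3 a}" if "{apex1 a, apex2 a} \<subseteq> t"
      using star_cases[OF a(2,3) t] that by (simp add: a(1) bipyramid_vertices)
  next
    fix a b assume "a \<in> I" "b \<in> I"
    then obtain i k i' k' where ab: "a = (i, k)" "i < n" "k < n" "b = (i', k')" "i' < n" "k' < n"
      by (auto simp: I_def)
    show "a = b" if "{base1 a, base2 a, base3 a} = {base1 b, base2 b, base3 b}"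
    proof -
      have e: "{X (i' + 2), Y (3 * k' + i'), Rv k'} = {X (i + 2), Y (3 * k + i), Rv k}"
        using that unfolding ab(1,4) bipyramid_vertices by (simp only: prod.case)
      \<comment> \<open>The base triangle has a single X-vertex, which determines \<open>i\<close>,
        and a single cone point, which determines \<open>k\<close>.\<close>
      have "X (i + 2) \<in> {X (i' + 2), Y (3 * k' + i'), Rv k'}" "Rv k \<in> {X (i' + 2), Y (3 * k' + i'), Rv k'}"
        unfolding e by simp_all
      then have "X (i + 2) = X (i' + 2)" "k = k'" by auto
      moreover from this have "X i = X i'" by (simp only: X_add_iff)
      ultimately show ?thesis using X_inj[of i i'] ab by simp
    qed
    show "a = b" if "t \<in> T" "{apex1 a, apex2 a} \<subseteq> t" "{apex1 b, apex2 b} \<subseteq> t" for t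
      using star_disjoint[OF ab(2,3,5,6) that(1)] that(2,3) by (simp add: ab(1,4) bipyramid_vertices)
  qed
  moreover have "card I = n^2" by (simp add: I_def power2_eq_square)
  ultimately show ?thesis by (simp only: card_vertex_set)
qed

end

lemma combinatorially_equivalent_refl: "combinatorially_equivalent P P"
  unfolding combinatorially_equivalent_def by (intro exI[of _ id]) (simp add: bij_betw_id)

theorem theorem1p1:
  fixes n :: nat
  assumes "n \<ge> 1"
  shows "\<exists>(X :: (real^4) topology) K P h.
    polyhedral_3_sphere X K P h \<and>
    card (cells_of_dim K P 0) = 5 * n + 4 \<and>
    (\<exists>S \<subseteq> cells_of_dim K P 3. card S = n^2 \<and>
      (\<forall>C\<in>S. \<exists>B. bipyramid B \<and> combinatorially_equivalent (P C) B))"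
proof -
  interpret strips n by unfold_locales (rule assms)
  \<comment> \<open>The polytope of a merged cell is itself a bipyramid and serves as its own model
    \<open>B\<close>.\<close>
  show ?thesis
    using polyhedral_sphere_with_bipyramids combinatorially_equivalent_refl by blast
qed

end
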